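(* Let $G$ be a finite nonabelian nested $p$-group with chain of centers $G=X_0>X_1>\dots>X_n\ge1$, and put $d_i=|G:X_i|^{1/2}$ for $i=0,\dots,n$. If $G'\le X_n$, then $|[X_{i-1},G]:[X_i,G]|\le d_i$ for all $i=1,\dots,n$; in particular $|G'|\le d_1d_2\cdots d_n$.
   Context: For $\chi\in\mathrm{Irr}(G)$, $Z(\chi)=\{g\in G: |\chi(g)|=\chi(1)\}$. $G$ is nested if for all $\chi,\psi\in\mathrm{Irr}(G)$ either $Z(\chi)\le Z(\psi)$ or $Z(\psi)\le Z(\chi)$; then the distinct subgroups $Z(\chi)$ form a chain $G=X_0>X_1>\dots>X_n\ge1$, the chain of centers (one has $X_n=Z(G)$, and under the hypothesis the indices $|G:X_i|$ are perfect squares). *)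

theory Defs
  imports "HOL-Algebra.Generated_Groups" "Jordan_Normal_Form.Matrix"
begin

definition mat_trace :: "complex mat \<Rightarrow> complex" where
  "mat_trace A = (\<Sum>i<dim_row A. A $$ (i, i))"

definition is_rep :: "('a, 'b) monoid_scheme \<Rightarrow> nat \<Rightarrow> ('a \<Rightarrow> complex mat) \<Rightarrow> bool" where
  "is_rep G d \<rho> \<longleftrightarrow>
     (\<forall>g\<in>carrier G. \<rho> g \<in> carrier_mat d d) \<and>
     \<rho> \<one>\<^bsub>G\<^esub> = 1\<^sub>m d \<and>
     (\<forall>g\<in>carrier G. \<forall>h\<in>carrier G. \<rho> (g \<otimes>\<^bsub>G\<^esub> h) = \<rho> g * \<rho> h)"

definition invariant_subspace ::
  "('a, 'b) monoid_scheme \<Rightarrow> nat \<Rightarrow> ('a \<Rightarrow> complex mat) \<Rightarrow> complex vec set \<Rightarrow> bool" where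
  "invariant_subspace G d \<rho> W \<longleftrightarrow>
     W \<subseteq> carrier_vec d \<and> 0\<^sub>v d \<in> W \<and>
     (\<forall>v\<in>W. \<forall>w\<in>W. v + w \<in> W) \<and>
     (\<forall>c::complex. \<forall>v\<in>W. c \<cdot>\<^sub>v v \<in> W) \<and>
     (\<forall>g\<in>carrier G. \<forall>v\<in>W. \<rho> g *\<^sub>v v \<in> W)"

definition irred_rep :: "('a, 'b) monoid_scheme \<Rightarrow> nat \<Rightarrow> ('a \<Rightarrow> complex mat) \<Rightarrow> bool" where
  "irred_rep G d \<rho> \<longleftrightarrow> is_rep G d \<rho> \<and> d > 0 \<and>
     (\<forall>W. invariant_subspace G d \<rho> W \<longrightarrow> W = {0\<^sub>v d} \<or> W = carrier_vec d)"

text \<open>Irr(G): the characters of irreducible complex representations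
  (as functions on the carrier; values outside the carrier are irrelevant).\<close>
definition irr_char :: "('a, 'b) monoid_scheme \<Rightarrow> ('a \<Rightarrow> complex) \<Rightarrow> bool" where
  "irr_char G \<chi> \<longleftrightarrow> (\<exists>d \<rho>. irred_rep G d \<rho> \<and> (\<forall>g\<in>carrier G. \<chi> g = mat_trace (\<rho> g)))"

definition char_center :: "('a, 'b) monoid_scheme \<Rightarrow> ('a \<Rightarrow> complex) \<Rightarrow> 'a set" where
  "char_center G \<chi> = {g \<in> carrier G. complex_of_real (cmod (\<chi> g)) = \<chi> \<one>\<^bsub>G\<^esub>}"

definition nested :: "('a, 'b) monoid_scheme \<Rightarrow> bool" where
  "nested G \<longleftrightarrow> (\<forall>\<chi> \<psi>. irr_char G \<chi> \<longrightarrow> irr_char G \<psi> \<longrightarrow>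
      char_center G \<chi> \<subseteq> char_center G \<psi> \<or> char_center G \<psi> \<subseteq> char_center G \<chi>)"

definition centers :: "('a, 'b) monoid_scheme \<Rightarrow> 'a set set" where
  "centers G = {char_center G \<chi> | \<chi>. irr_char G \<chi>}"

definition comm_subgroup :: "('a, 'b) monoid_scheme \<Rightarrow> 'a set \<Rightarrow> 'a set \<Rightarrow> 'a set" where
  "comm_subgroup G H K = generate G
     (\<Union>h\<in>H. \<Union>k\<in>K. {inv\<^bsub>G\<^esub> h \<otimes>\<^bsub>G\<^esub> inv\<^bsub>G\<^esub> k \<otimes>\<^bsub>G\<^esub> h \<otimes>\<^bsub>G\<^esub> k})"

end

theory Submission
  imports Defs "HOL-Number_Theory.Number_Theory" "Jordan_Normal_Form.Spectral_Radius"
begin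

text \<open>Irreducible characters separate the points of \<open>G\<close>, so \<open>X\<^sub>n = Z(G)\<close> and \<open>G\<close> has class at most two; hence
  \<open>[g,G]\<close> consists of the commutators of \<open>g\<close>.  For \<open>g\<close> outside \<open>X\<^sub>i\<close>, a character whose kernel contains the
  central subgroup \<open>[g,G][X\<^sub>i,G]\<close> has center \<open>X\<^sub>j\<close> with \<open>j < i\<close>, so its kernel contains \<open>[X\<^bsub>i-1\<^esub>,G]\<close>.  Therefore
  \<open>[X\<^bsub>i-1\<^esub>,G] \<le> [g,G][X\<^sub>i,G]\<close> for every such \<open>g\<close>: modulo \<open>[X\<^sub>i,G]\<close>, the commutator pairing of \<open>G/X\<^sub>i\<close> with
  itself maps \<open>{g} \<times> G/X\<^sub>i\<close> onto a group containing \<open>N = [X\<^bsub>i-1\<^esub>,G]/[X\<^sub>i,G]\<close>.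

  That \<open>|N|\<^sup>2 \<le> |G/X\<^sub>i|\<close> is reduced to a statement on vector spaces over the field of \<open>p\<close> elements: if all nonzero
  members of a \<open>k\<close>-dimensional space of alternating forms on a space of dimension \<open>2m\<close> are nondegenerate, then \<open>k \<le> m\<close>.
  Indeed the Pfaffian is a polynomial of degree \<open>m\<close> in \<open>k\<close> variables with no nontrivial zero, and the
  Chevalley-Warning argument applies.\<close>

section \<open>Pfaffians\<close>

text \<open>Surjectivity of the pairing at one \<open>g\<close> yields by counting only that |N| is
  at most |G:\<open>X i\<close>|. The square root comes from alternation: the Pfaffian is a square
  root of the determinant and has half its degree, and this factor two is what the polynomial count
  gains in the dimension \<open>k\<close>.

  All forms are kept integer valued and every condition is divisibility by \<open>p\<close>. Over
  the integers antisymmetry alone makes a Pfaffian with a repeated entry vanish, while over the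
  field of two elements it would not; this is how p = 2 is covered together with the odd primes.

  The quotients G/\<open>X i\<close> and Z(G)/[\<open>X i\<close>,G] need not be elementary abelian.
  Restricting the first argument to \<open>q\<close>-th powers loses nothing: some nontrivial
  \<open>q\<close>-th power still pairs onto \<open>N\<close>, which forces \<open>N\<close> to have
  exponent \<open>p\<close>, and the group of \<open>q\<close>-th powers is no larger than the group
  itself.

  For the characters, unitarity is present from the start: the regular representation consists of
  permutation matrices, and orthogonal projections pass unitarity on to subrepresentations.\<close>

fun contract :: "('v \<Rightarrow> 'v \<Rightarrow> int) \<Rightarrow> 'v \<Rightarrow> ('v list \<Rightarrow> int) \<Rightarrow> 'v list \<Rightarrow> int" where
  "contract f x F [] = 0"
| "contract f x F (z # zs) = f x z * F zs - contract f x (\<lambda>l. F (z # l)) zs"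

text \<open>Expansion along the first row. \<open>contract f x F zs\<close> is an interior product:
  the alternating sum, over the positions in \<open>zs\<close>, of \<open>f x z\<close> times
  \<open>F\<close> at the list with that entry \<open>z\<close> deleted. For \<open>m = 0\<close>
  the value is 1 on every list, so the Pfaffian proper is meant only at lists of length
  \<open>2 * m\<close>; hence the length conditions below.\<close>

primrec pfaffian :: "('v \<Rightarrow> 'v \<Rightarrow> int) \<Rightarrow> nat \<Rightarrow> 'v list \<Rightarrow> int" where
  "pfaffian f 0 = (\<lambda>xs. 1)"
| "pfaffian f (Suc m) = (\<lambda>xs. case xs of [] \<Rightarrow> 0 | x # ys \<Rightarrow> contract f x (pfaffian f m) ys)"

lemma contract_cong:
  "(\<And>l. Suc (length l) = length zs \<Longrightarrow> F l = F' l) \<Longrightarrow> contract f x F zs = contract f x F' zs"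
proof (induction zs arbitrary: F F')
  case (Cons z zs)
  have "contract f x (\<lambda>l. F (z # l)) zs = contract f x (\<lambda>l. F' (z # l)) zs"
    by (rule Cons.IH) (simp add: Cons.prems)
  then show ?case by (simp add: Cons.prems)
qed simp

lemma contract_diff:
  "contract f x (\<lambda>l. a * F l - G l) zs = a * contract f x F zs - contract f x G zs"
  by (induction zs arbitrary: F G) (auto simp: algebra_simps)

lemma contract_minus: "contract f x (\<lambda>l. - F l) zs = - contract f x F zs"
  using contract_diff[of f x 0 F F zs] by simp

text \<open>Deleting the same two entries in the opposite order produces the same coefficients with
  the opposite sign.\<close>

lemma contract_anticommute:
  "contract f x (contract f y F) zs = - contract f y (contract f x F) zs"
proof (induction zs arbitrary: F)
  case (Cons z zs)
  show ?case
    using Cons[of "\<lambda>l. F (z # l)"] by (simp add: contract_diff)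
qed simp

text \<open>The terms that delete \<open>x\<close> or \<open>y\<close> are exchanged with a change
  of sign; all others keep both entries, where the antisymmetry of \<open>F\<close> applies. It is
  assumed for lists one shorter only, because \<open>pfaffian f m\<close> alternates only at the
  proper length.\<close>

lemma contract_swap:
  assumes "\<And>as bs. length as + length bs + 1 = length us + length zs \<Longrightarrow>
             F (as @ x # y # bs) = - F (as @ y # x # bs)"
  shows "contract f w F (us @ x # y # zs) = - contract f w F (us @ y # x # zs)"
  using assms
proof (induction us arbitrary: F)
  case Nil
  have "contract f w (\<lambda>l. F (x # y # l)) zs = contract f w (\<lambda>l. - F (y # x # l)) zs"
    by (rule contract_cong) (use Nil[of "[]"] in auto)
  then show ?case by (simp add: contract_minus)
next
  case (Cons v us)
  have "F (us @ x # y # zs) = - F (us @ y # x # zs)"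
    using Cons.prems by simp
  moreover have "contract f w (\<lambda>l. F (v # l)) (us @ x # y # zs)
      = - contract f w (\<lambda>l. F (v # l)) (us @ y # x # zs)"
    by (rule Cons.IH) (use Cons.prems[of "v # as" for as] in auto)
  ultimately show ?case by simp
qed

text \<open>Behind the head the swap passes under the contraction. At the head, one term changes
  sign with \<open>f x y\<close>, and the rest is a double contraction, which anticommutes.\<close>

lemma pfaffian_swap:
  assumes anti: "\<And>x y. f x y = - f y x"
    and "length us + length zs + 2 = 2 * m"
  shows "pfaffian f m (us @ x # y # zs) = - pfaffian f m (us @ y # x # zs)"
  using assms(2)
proof (induction m arbitrary: us zs)
  case (Suc m)
  show ?case
  proof (cases us)
    case Nil
    show ?thesis
    proof (cases m)
      case 0
      with Nil Suc.prems anti[of x y] show ?thesis by simp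
    next
      case m: (Suc m')
      have "contract f x (\<lambda>l. pfaffian f m (y # l)) zs = contract f x (contract f y (pfaffian f m')) zs" for x y
        using m by simp
      then show ?thesis
        using Nil anti[of x y] contract_anticommute[of f x y "pfaffian f m'" zs] by simp
    qed
  next
    case (Cons w us')
    then show ?thesis
      using contract_swap[of us' zs "pfaffian f m" x y f w] Suc by simp
  qed
qed simp

text \<open>Absolute values discard the sign of the permutation; only divisibility by
  \<open>p\<close> will matter.\<close>

lemma pfaffian_move:
  assumes anti: "\<And>x y. f x y = - f y x"
    and "length us + length as + length bs + 1 = 2 * m"
  shows "\<bar>pfaffian f m (us @ as @ x # bs)\<bar> = \<bar>pfaffian f m (us @ x # as @ bs)\<bar>"
  using assms(2)
proof (induction as arbitrary: us)
  case (Cons a as)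
  have "\<bar>pfaffian f m ((us @ [a]) @ as @ x # bs)\<bar> = \<bar>pfaffian f m ((us @ [a]) @ x # as @ bs)\<bar>"
    by (rule Cons.IH) (use Cons.prems in simp)
  also have "\<dots> = \<bar>pfaffian f m (us @ x # a # as @ bs)\<bar>"
    using pfaffian_swap[of f us "as @ bs" m a x, OF anti] Cons.prems by simp
  finally show ?case by simp
qed simp

lemma pfaffian_permute:
  assumes anti: "\<And>x y. f x y = - f y x"
    and "mset xs = mset ys" "length us + length xs = 2 * m"
  shows "\<bar>pfaffian f m (us @ xs)\<bar> = \<bar>pfaffian f m (us @ ys)\<bar>"
  using assms(2,3)
proof (induction xs arbitrary: us ys)
  case (Cons x xs)
  have "x \<in> set ys" using Cons.prems(1) by (metis list.set_intros(1) mset_eq_setD)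
  then obtain as bs where ys: "ys = as @ x # bs" by (meson split_list)
  have ms: "mset xs = mset (as @ bs)" using Cons.prems(1) ys by simp
  have len: "length xs = length as + length bs" using mset_eq_length[OF ms] by simp
  have "\<bar>pfaffian f m ((us @ [x]) @ xs)\<bar> = \<bar>pfaffian f m ((us @ [x]) @ as @ bs)\<bar>"
    by (rule Cons.IH) (use Cons.prems ms in auto)
  also have "\<dots> = \<bar>pfaffian f m (us @ ys)\<bar>"
    using pfaffian_move[of f us as bs m x, OF anti] Cons.prems len ys by simp
  finally show ?case by simp
qed simp

text \<open>Once the second copy stands next to the head, swapping the two copies changes nothing,
  so the value is its own negative, which in the integers means zero.\<close>

lemma pfaffian_repeat:
  assumes anti: "\<And>x y. f x y = - f y x"
    and "b \<in> set ys" "Suc (length ys) = 2 * m"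
  shows "pfaffian f m (b # ys) = 0"
proof -
  obtain as bs where ys: "ys = as @ b # bs" using assms(2) by (meson split_list)
  have "\<bar>pfaffian f m (b # ys)\<bar> = \<bar>pfaffian f m ([] @ b # b # as @ bs)\<bar>"
    using pfaffian_move[of f "[b]" as bs m b, OF anti] assms(3) ys by simp
  moreover have "pfaffian f m ([] @ b # b # as @ bs) = - pfaffian f m ([] @ b # b # as @ bs)"
    by (rule pfaffian_swap[OF anti]) (use assms(3) ys in auto)
  ultimately show ?thesis by simp
qed

text \<open>\<open>contract\<close> is linear in the form \<open>f b\<close>. The point is that
  \<open>c\<close> depends on \<open>F\<close> and \<open>zs\<close> but not on \<open>b\<close>, so
  one vector serves all \<open>b\<close> at once.\<close>

lemma contract_linear_combination:
  assumes "distinct zs"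
  shows "\<exists>c. (\<forall>l. l \<notin> set zs \<longrightarrow> c l = 0) \<and> (\<forall>b. contract f b F zs = (\<Sum>l\<in>set zs. c l * f b l))"
  using assms
proof (induction zs arbitrary: F)
  case (Cons z zs)
  then obtain c where c: "\<forall>l. l \<notin> set zs \<longrightarrow> c l = 0"
      "\<forall>b. contract f b (\<lambda>l. F (z # l)) zs = (\<Sum>l\<in>set zs. c l * f b l)"
    by (metis distinct.simps(2))
  let ?c = "\<lambda>l. if l = z then F zs else - c l"
  have "(\<Sum>l\<in>set zs. ?c l * f b l) = - (\<Sum>l\<in>set zs. c l * f b l)" for b
    unfolding sum_negf[symmetric] by (rule sum.cong) (use Cons.prems in auto)
  then have "contract f b F (z # zs) = (\<Sum>l\<in>set (z # zs). ?c l * f b l)" for b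
    using Cons.prems c(2) by simp
  with c(1) show ?case by (intro exI[of _ ?c]) auto
qed auto

text \<open>Take \<open>S\<close> of maximal even length with \<open>p\<close> not dividing its Pfaffian.  For \<open>a\<close> outside
  \<open>S\<close> the contraction of \<open>a # S\<close> is, as a linear form, a vector of the radical whose
  coefficient at \<open>a\<close> is the Pfaffian of \<open>S\<close>; so \<open>S\<close> exhausts the basis.\<close>

lemma nondegenerate_pfaffian:
  fixes f :: "nat \<Rightarrow> nat \<Rightarrow> int"
  assumes anti: "\<And>x y. f x y = - f y x"
    and nondeg: "\<And>x. \<exists>l<r. \<not> p dvd x l \<Longrightarrow> \<exists>j<r. \<not> p dvd (\<Sum>l<r. x l * f l j)"
    and p: "\<not> p dvd 1"
  shows "even r \<and> \<not> p dvd pfaffian f (r div 2) [0..<r]"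
proof -
  define P where "P m \<longleftrightarrow> (\<exists>S. distinct S \<and> set S \<subseteq> {..<r} \<and> length S = 2 * m \<and> \<not> p dvd pfaffian f m S)" for m
  have bound: "2 * m \<le> r" if "P m" for m
  proof -
    obtain S where S: "distinct S" "set S \<subseteq> {..<r}" "length S = 2 * m" using \<open>P m\<close> P_def by blast
    have "card (set S) \<le> card {..<r}" by (rule card_mono) (use S in auto)
    with S show ?thesis by (simp add: distinct_card)
  qed
  have "P 0" unfolding P_def using p by (intro exI[of _ "[]"]) auto
  moreover have "\<forall>m. P m \<longrightarrow> m \<le> r" using bound by force
  ultimately obtain m where m: "P m" and max: "\<And>m'. P m' \<Longrightarrow> m' \<le> m"
    using ex_has_greatest_nat[of P 0 "\<lambda>x. x" r] by force
  obtain S where S: "distinct S" "set S \<subseteq> {..<r}" "length S = 2 * m" "\<not> p dvd pfaffian f m S"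
    using m P_def by blast
  have "set S = {..<r}"
  proof (rule ccontr)
    assume "set S \<noteq> {..<r}"
    then obtain a where a: "a < r" "a \<notin> set S" using S(2) by blast
    have zero: "p dvd pfaffian f (Suc m) (b # a # S)" if "b < r" for b
    proof (cases "b \<in> set (a # S)")
      case True
      then show ?thesis using pfaffian_repeat[of f b "a # S" "Suc m", OF anti] S(3) by simp
    next
      case False
      have "\<not> P (Suc m)" using max by fastforce
      moreover have "distinct (b # a # S)" "set (b # a # S) \<subseteq> {..<r}" "length (b # a # S) = 2 * Suc m"
        using False S a that by auto
      ultimately show ?thesis unfolding P_def by blast
    qed
    obtain c where c: "\<forall>l. l \<notin> set S \<longrightarrow> c l = 0"
      "\<forall>b. contract f b (\<lambda>l. pfaffian f m (a # l)) S = (\<Sum>l\<in>set S. c l * f b l)"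
      using contract_linear_combination[OF S(1)] by blast
    \<comment> \<open>With these signs the antisymmetry of \<open>f\<close> turns the combination
      into minus the expansion of the Pfaffian of \<open>b # a # S\<close> along
      \<open>b\<close>.\<close>
    define x where "x l = (if l = a then pfaffian f m S else - c l)" for l
    have comb: "(\<Sum>l<r. x l * f l b) = - pfaffian f (Suc m) (b # a # S)" for b
    proof -
      have "(\<Sum>l<r. x l * f l b) = (\<Sum>l\<in>insert a (set S). x l * f l b)"
        by (rule sum.mono_neutral_right) (use S a c x_def in auto)
      also have "\<dots> = x a * f a b + (\<Sum>l\<in>set S. x l * f l b)"
        using a by simp
      also have "(\<Sum>l\<in>set S. x l * f l b) = (\<Sum>l\<in>set S. c l * f b l)"
      proof (rule sum.cong)
        fix l assume "l \<in> set S"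
        then show "x l * f l b = c l * f b l" using a anti[of l b] unfolding x_def by auto
      qed simp
      finally show ?thesis using c(2) anti[of a b] by (simp add: x_def)
    qed
    then have "p dvd (\<Sum>l<r. x l * f l j)" if "j < r" for j
      unfolding comb using zero[OF that] by (simp only: dvd_minus_iff)
    moreover have "\<exists>l<r. \<not> p dvd x l" using a S(4) x_def by auto
    ultimately show False using nondeg by blast
  qed
  then have ms: "mset S = mset [0..<r]"
    using S(1) by (metis atLeast_upt distinct_upt set_eq_iff_mset_eq_distinct)
  then have "length S = r" by (metis diff_zero length_upt mset_eq_length)
  then have r: "r = 2 * m" using S(3) by simp
  have "\<bar>pfaffian f m ([] @ S)\<bar> = \<bar>pfaffian f m ([] @ [0..<r])\<bar>"
    by (rule pfaffian_permute[OF anti ms]) (use S(3) in simp)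
  then have "\<not> p dvd pfaffian f m [0..<r]" using S(4) by (metis append_Nil dvd_abs_iff)
  then show ?thesis using r by simp
qed

section \<open>Polynomial functions and the Chevalley-Warning count\<close>

text \<open>Integer polynomial functions of the variables \<open>t 0\<close>, ...,
  \<open>t (k - 1)\<close>, presented as sums of monomials so that sums over a box of arguments can
  be treated by rule induction. Degrees are only bounded above, which makes constants and zero
  admissible at every \<open>d\<close>.\<close>

inductive deg_le :: "nat \<Rightarrow> nat \<Rightarrow> ((nat \<Rightarrow> int) \<Rightarrow> int) \<Rightarrow> bool" for k where
  monomial: "(\<Sum>i<k. a i) \<le> d \<Longrightarrow> deg_le k d (\<lambda>t. c * (\<Prod>i<k. t i ^ a i))"
| add: "deg_le k d F \<Longrightarrow> deg_le k d G \<Longrightarrow> deg_le k d (\<lambda>t. F t + G t)"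

lemma deg_le_const: "deg_le k d (\<lambda>t. c)"
  using monomial[of "\<lambda>_. 0" k d c] by simp

lemma deg_le_sum:
  "finite I \<Longrightarrow> (\<And>i. i \<in> I \<Longrightarrow> deg_le k d (F i)) \<Longrightarrow> deg_le k d (\<lambda>t. \<Sum>i\<in>I. F i t)"
  by (induction I rule: finite_induct) (auto intro: deg_le_const deg_le.add)

lemma deg_le_mult_monomial:
  assumes "(\<Sum>i<k. a i) \<le> d" "deg_le k e G"
  shows "deg_le k (d + e) (\<lambda>t. c * (\<Prod>i<k. t i ^ a i) * G t)"
  using assms(2)
proof induction
  case (monomial b e c')
  then have "deg_le k (d + e) (\<lambda>t. (c * c') * (\<Prod>i<k. t i ^ (a i + b i)))"
    by (intro deg_le.monomial) (use assms(1) in \<open>simp add: sum.distrib\<close>)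
  then show ?case by (simp add: power_add prod.distrib mult_ac)
next
  case (add e F G)
  then show ?case using deg_le.add by (fastforce simp: algebra_simps)
qed

lemma deg_le_mult:
  assumes "deg_le k d F" "deg_le k e G"
  shows "deg_le k (d + e) (\<lambda>t. F t * G t)"
  using assms(1)
proof induction
  case (monomial a d c)
  then show ?case using deg_le_mult_monomial[OF _ assms(2)] by simp
next
  case (add d F G)
  then show ?case using deg_le.add by (fastforce simp: algebra_simps)
qed

lemma deg_le_power: "deg_le k d F \<Longrightarrow> deg_le k (n * d) (\<lambda>t. F t ^ n)"
proof (induction n)
  case 0
  then show ?case using deg_le_const[of k 0 1] by simp
next
  case (Suc n)
  then show ?case using deg_le_mult[of k d F "n * d" "\<lambda>t. F t ^ n"] by simp
qed

lemma deg_le_linear: "deg_le k 1 (\<lambda>t. \<Sum>i<k. t i * a i)"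
proof (rule deg_le_sum)
  fix i assume i: "i \<in> {..<k}"
  have "(\<Prod>j<k. t j ^ (if j = i then 1 else 0)) = t i" for t :: "nat \<Rightarrow> int"
    using i by (subst prod.remove[of _ i]) auto
  moreover have "(\<Sum>j<k. if j = i then 1 else 0 :: nat) = 1" using i by simp
  ultimately show "deg_le k 1 (\<lambda>t. t i * a i)"
    using deg_le.monomial[of "\<lambda>j. if j = i then 1 else 0" k 1 "a i"] by (simp add: mult.commute)
qed simp

lemma deg_le_contract:
  assumes lin: "\<And>x y. deg_le k 1 (\<lambda>t. f t x y)"
  shows "(\<And>l. deg_le k d (\<lambda>t. F t l)) \<Longrightarrow> deg_le k (Suc d) (\<lambda>t. contract (f t) x (F t) zs)"
proof (induction zs arbitrary: F)
  case Nil
  then show ?case by (simp add: deg_le_const)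
next
  case (Cons z zs)
  have "deg_le k (1 + d) (\<lambda>t. f t x z * F t zs)"
    by (intro deg_le_mult lin Cons.prems)
  moreover have "deg_le k (0 + Suc d) (\<lambda>t. (- 1) * contract (f t) x (\<lambda>l. F t (z # l)) zs)"
    by (rule deg_le_mult[OF deg_le_const Cons.IH]) (rule Cons.prems)
  ultimately show ?case using deg_le.add by fastforce
qed

text \<open>Each of the \<open>m\<close> levels of the expansion contributes one entry, linear in
  \<open>t\<close>. A determinant of the same size would have degree \<open>2 * m\<close>.\<close>

lemma deg_le_pfaffian:
  assumes "\<And>x y. deg_le k 1 (\<lambda>t. f t x y)"
  shows "deg_le k m (\<lambda>t. pfaffian (f t) m xs)"
proof (induction m arbitrary: xs)
  case (Suc m)
  show ?case
  proof (cases xs)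
    case (Cons x xs')
    then show ?thesis using deg_le_contract[OF assms Suc.IH] by simp
  qed (simp add: deg_le_const)
qed (simp add: deg_le_const)

text \<open>The differences of consecutive (a+1)-th powers telescope to p^(a+1). Expanded binomially
  they give \<open>a + 1\<close> times the wanted sum plus multiples of lower power sums, and
  \<open>a + 1 < p\<close> is invertible modulo \<open>p\<close>. Since \<open>0 ^ 0 = 1\<close>,
  the sum for \<open>a = 0\<close> is \<open>p\<close>.\<close>

lemma prime_dvd_power_sum:
  fixes p :: nat
  assumes p: "Factorial_Ring.prime p" and "a < p - 1"
  shows "int p dvd (\<Sum>x<p. int x ^ a)"
  using assms(2)
proof (induction a rule: less_induct)
  case (less a)
  let ?S = "\<lambda>j. \<Sum>x<p. int x ^ j"
  have tel: "(\<Sum>x<n. (int x + 1) ^ Suc a - int x ^ Suc a) = int n ^ Suc a" for n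
    by (induction n) (auto simp: algebra_simps)
  have bin: "(int x + 1) ^ Suc a - int x ^ Suc a = (\<Sum>j\<le>a. of_nat (Suc a choose j) * int x ^ j)" for x
    using binomial_ring[of "int x" 1 "Suc a"] by simp
  have "int p ^ Suc a = (\<Sum>x<p. \<Sum>j\<le>a. of_nat (Suc a choose j) * int x ^ j)"
    using tel[of p] by (simp only: bin)
  also have "\<dots> = (\<Sum>j\<le>a. of_nat (Suc a choose j) * ?S j)"
    by (subst sum.swap) (simp add: sum_distrib_left)
  also have "\<dots> = (\<Sum>j<a. of_nat (Suc a choose j) * ?S j) + int (Suc a) * ?S a"
    by (simp add: lessThan_Suc_atMost[symmetric])
  finally have eq: "int (Suc a) * ?S a = int p ^ Suc a - (\<Sum>j<a. of_nat (Suc a choose j) * ?S j)"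
    by simp
  have "int p dvd (\<Sum>j<a. of_nat (Suc a choose j) * ?S j)"
    using less by (intro dvd_sum dvd_mult less.IH) auto
  then have "int p dvd int (Suc a) * ?S a" unfolding eq by (intro dvd_diff) auto
  moreover have "\<not> int p dvd int (Suc a)"
    using less.prems by (subst int_dvd_int_iff) (auto dest: dvd_imp_le)
  ultimately show ?case using p by (meson prime_dvd_mult_iff prime_int_nat_transfer prime_nat_int_transfer)
qed

text \<open>A monomial of degree below \<open>k * (p - 1)\<close> has some exponent below
  \<open>p - 1\<close>. Its sum over the box factors into power sums in one variable, and the factor
  of that exponent is divisible by \<open>p\<close>.\<close>

lemma prime_dvd_sum_deg_le:
  fixes p :: nat
  assumes p: "Factorial_Ring.prime p" and "deg_le k d F" "d < k * (p - 1)"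
  shows "int p dvd (\<Sum>t\<in>PiE {..<k} (\<lambda>_. {0..<int p}). F t)"
  using assms(2,3)
proof induction
  case (monomial a d c)
  have "\<exists>i<k. a i < p - 1"
  proof (rule ccontr)
    assume "\<not> ?thesis"
    then have "(\<Sum>i<k. p - 1) \<le> (\<Sum>i<k. a i)" by (intro sum_mono) auto
    with monomial show False by simp
  qed
  then obtain i where i: "i < k" "a i < p - 1" by blast
  have "(\<Sum>x\<in>{0..<int p}. x ^ a i) = (\<Sum>x<p. int x ^ a i)"
    by (rule sum.reindex_bij_witness[of _ int nat]) auto
  then have "int p dvd (\<Sum>x\<in>{0..<int p}. x ^ a i)"
    using prime_dvd_power_sum[OF p i(2)] by simp
  then have "int p dvd (\<Prod>i<k. \<Sum>x\<in>{0..<int p}. x ^ a i)"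
    using i(1) by (meson dvd_prod_eqI dvd_trans finite_lessThan lessThan_iff dvd_prodI)
  also have "(\<Prod>i<k. \<Sum>x\<in>{0..<int p}. x ^ a i) = (\<Sum>t\<in>PiE {..<k} (\<lambda>_. {0..<int p}). \<Prod>i<k. t i ^ a i)"
    by (rule prod_sum_PiE) auto
  finally show ?case by (simp add: sum_distrib_left[symmetric])
next
  case (add d F G)
  then show ?case by (simp add: sum.distrib)
qed

lemma fermat_theorem_int:
  fixes p :: nat
  assumes "Factorial_Ring.prime p" "\<not> int p dvd x"
  shows "[x ^ (p - 1) = 1] (mod int p)"
proof -
  define n where "n = nat (x mod int p)"
  have n: "int n = x mod int p" using prime_gt_0_nat[OF assms(1)] by (simp add: n_def)
  then have "\<not> p dvd n" using assms(2) by (metis dvd_mod_iff dvd_refl int_dvd_int_iff)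
  then have "[int n ^ (p - 1) = 1] (mod int p)"
    using fermat_theorem[OF assms(1)] by (metis cong_int_iff of_nat_1 of_nat_power)
  moreover have "[x ^ (p - 1) = int n ^ (p - 1)] (mod int p)"
    by (intro cong_pow) (simp add: n)
  ultimately show ?thesis by (rule cong_trans[rotated])
qed

text \<open>Suppose \<open>r < 2 * k\<close>. Modulo \<open>p\<close>, the (p-1)-th power of the
  Pfaffian is 1 at every nonzero \<open>t\<close> and 0 at zero, so its sum over the box is p^k - 1.
  Its degree is too small for this, as it makes the sum divisible by \<open>p\<close>.\<close>

theorem nondegenerate_alternating_forms_bound:
  fixes a :: "nat \<Rightarrow> nat \<Rightarrow> nat \<Rightarrow> int" and p :: nat
  assumes p: "Factorial_Ring.prime p" and "0 < r"
    and anti: "\<And>i x y. a i x y = - a i y x"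
    and nondeg: "\<And>t x. \<lbrakk>\<exists>i<k. \<not> int p dvd t i; \<exists>l<r. \<not> int p dvd x l\<rbrakk> \<Longrightarrow>
       \<exists>j<r. \<not> int p dvd (\<Sum>l<r. x l * (\<Sum>i<k. t i * a i l j))"
  shows "2 * k \<le> r"
proof (rule ccontr)
  assume less: "\<not> 2 * k \<le> r"
  define f where "f t x y = (\<Sum>i<k. t i * a i x y)" for t :: "nat \<Rightarrow> int" and x y
  define T where "T = PiE {..<k} (\<lambda>_. {0..<int p})"
  \<comment> \<open>The zero vector of the box; restricting the function fixes its values outside
    \<open>{..<k}\<close>, so it is the only member of \<open>T\<close> whose \<open>k\<close>
    coordinates all vanish.\<close>
  define z where "z = (\<lambda>i\<in>{..<k}. 0 :: int)"
  define F where "F t = pfaffian (f t) (r div 2) [0..<r] ^ (p - 1)" for t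
  have p1: "p - 1 > 0" using p prime_gt_1_nat by fastforce
  have anti': "f t x y = - f t y x" for t x y
    unfolding f_def by (simp add: anti[of _ x y] sum_negf)
  have finT: "finite T" unfolding T_def by (intro finite_PiE) auto
  have zT: "z \<in> T" unfolding z_def T_def using p prime_gt_0_nat by auto
  have even: "even r \<and> \<not> int p dvd pfaffian (f t) (r div 2) [0..<r]" if "t \<in> T" "t \<noteq> z" for t
  proof (rule nondegenerate_pfaffian)
    have "\<exists>i<k. t i \<noteq> 0"
    proof (rule ccontr)
      assume "\<not> ?thesis"
      then have "t = z" using that(1) unfolding T_def z_def
        by (intro ext) (auto simp: PiE_def extensional_def)
      with that(2) show False ..
    qed
    then obtain i where i: "i < k" "t i \<noteq> 0" by blast
    moreover have "t i \<in> {0..<int p}" using PiE_mem[of t "{..<k}" "\<lambda>_. {0..<int p}" i] i(1) that(1)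
      unfolding T_def by simp
    ultimately have "\<not> int p dvd t i" by (intro zdvd_not_zless) auto
    with i(1) have "\<exists>i<k. \<not> int p dvd t i" by blast
    then show "\<exists>j<r. \<not> int p dvd (\<Sum>l<r. x l * f t l j)" if "\<exists>l<r. \<not> int p dvd x l" for x
      unfolding f_def using nondeg that by blast
    show "\<not> int p dvd 1" using prime_gt_1_nat[OF p] by simp
  qed (rule anti')
  have ones: "[F t = 1] (mod int p)" if "t \<in> T - {z}" for t
  proof -
    have "\<not> int p dvd pfaffian (f t) (r div 2) [0..<r]" using even that by blast
    then show ?thesis unfolding F_def by (rule fermat_theorem_int[OF p])
  qed
  have "r div 2 * (p - 1) < k * (p - 1)"
    using less p1 by (intro mult_strict_right_mono) auto
  moreover have "deg_le k ((p - 1) * (r div 2)) F"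
    unfolding F_def by (intro deg_le_power deg_le_pfaffian) (simp only: f_def deg_le_linear)
  ultimately have "int p dvd (\<Sum>t\<in>T. F t)"
    unfolding T_def using prime_dvd_sum_deg_le[OF p] by (simp add: mult.commute)
  moreover have "(\<Sum>t\<in>T. F t) = F z + (\<Sum>t\<in>T - {z}. F t)"
    using finT zT by (rule sum.remove)
  moreover have "[(\<Sum>t\<in>T - {z}. F t) = (\<Sum>t\<in>T - {z}. 1)] (mod int p)"
    by (rule cong_sum) (use ones in auto)
  \<comment> \<open>The empty Pfaffian is 1 even for the zero form, so \<open>r div 2\<close> must
    be positive. This follows from \<open>0 < r\<close> once \<open>r\<close> is known to be even,
    which any nonzero \<open>t\<close> in the box shows.\<close>
  moreover have "F z = 0"
  proof -
    have k: "0 < k" using less by auto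
    obtain t where t: "t \<in> T" "t \<noteq> z"
    proof
      let ?t = "\<lambda>i\<in>{..<k}. 1 :: int"
      show "?t \<in> T" unfolding T_def using p prime_gt_1_nat by auto
      show "?t \<noteq> z" using k unfolding z_def by (metis lessThan_iff restrict_apply' zero_neq_one)
    qed
    have "even r" using even t by blast
    with \<open>0 < r\<close> obtain m where m: "r div 2 = Suc m" by (cases "r div 2") auto
    have f0: "f z = (\<lambda>x y. 0)" unfolding f_def z_def by (auto simp: fun_eq_iff)
    have c0: "contract (\<lambda>x y. 0) b H zs = 0" for b :: nat and H zs
      by (induction zs arbitrary: H) auto
    have "pfaffian (f z) (r div 2) [0..<r] = 0"
      unfolding f0 m using \<open>0 < r\<close> c0 by (simp add: upt_conv_Cons)
    then show ?thesis unfolding F_def using p1 by simp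
  qed
  moreover have "(\<Sum>t\<in>T - {z}. 1 :: int) = int p ^ k - 1"
  proof -
    have "card T = p ^ k" unfolding T_def by (simp add: card_PiE)
    then show ?thesis using finT zT prime_gt_0_nat[OF p] by (simp add: of_nat_diff)
  qed
  ultimately have "[int p ^ k - 1 = 0] (mod int p)"
    by (metis add_0 cong_0_iff cong_sym cong_trans)
  then have "int p dvd int p ^ k - 1" by (simp add: cong_0_iff)
  moreover have "int p dvd int p ^ k" using less by (intro dvd_power) auto
  ultimately have "int p dvd int p ^ k - (int p ^ k - 1)" by (rule dvd_diff[rotated])
  then have "int p dvd 1" by simp
  then show False using prime_gt_1_nat[OF p] by simp
qed

section \<open>Alternating pairings of finite abelian groups\<close>

primrec lincomb :: "('a, 'b) monoid_scheme \<Rightarrow> (nat \<Rightarrow> 'a) \<Rightarrow> (nat \<Rightarrow> int) \<Rightarrow> nat \<Rightarrow> 'a" where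
  "lincomb G b t 0 = \<one>\<^bsub>G\<^esub>"
| "lincomb G b t (Suc n) = lincomb G b t n \<otimes>\<^bsub>G\<^esub> b n [^]\<^bsub>G\<^esub> t n"

lemma lincomb_cong:
  "(\<And>i. i < n \<Longrightarrow> b i = c i \<and> t i = s i) \<Longrightarrow> lincomb G b t n = lincomb G c s n"
  by (induction n) auto

context comm_group
begin

lemma lincomb_closed [simp]: "(\<And>i. i < n \<Longrightarrow> b i \<in> carrier G) \<Longrightarrow> lincomb G b t n \<in> carrier G"
  by (induction n) auto

lemma lincomb_in_subgroup:
  assumes "subgroup S G"
  shows "(\<And>i. i < n \<Longrightarrow> b i \<in> S) \<Longrightarrow> lincomb G b t n \<in> S"
  by (induction n) (auto simp: assms subgroup.one_closed subgroup.m_closed subgroup_int_pow_closed)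

lemma lincomb_add:
  "(\<And>i. i < n \<Longrightarrow> b i \<in> carrier G) \<Longrightarrow>
    lincomb G b (\<lambda>i. t i + s i) n = lincomb G b t n \<otimes> lincomb G b s n"
  by (induction n) (simp_all add: int_pow_mult m_ac)

lemma lincomb_zero: "(\<And>i. i < n \<Longrightarrow> b i \<in> carrier G) \<Longrightarrow> lincomb G b (\<lambda>_. 0) n = \<one>"
  by (induction n) simp_all

lemma lincomb_int_pow:
  fixes z :: int
  shows "(\<And>i. i < n \<Longrightarrow> b i \<in> carrier G) \<Longrightarrow> lincomb G b t n [^] z = lincomb G b (\<lambda>i. z * t i) n"
proof (induction n)
  case (Suc n)
  have "lincomb G b t (Suc n) [^] z = lincomb G b t n [^] z \<otimes> (b n [^] t n) [^] z"
    using Suc.prems by (simp add: int_pow_distrib)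
  then show ?case using Suc by (simp add: int_pow_pow mult.commute)
qed simp

lemma lincomb_base_pow:
  fixes q :: nat
  shows "(\<And>i. i < n \<Longrightarrow> b i \<in> carrier G) \<Longrightarrow> lincomb G (\<lambda>i. b i [^] q) t n = lincomb G b t n [^] q"
proof (induction n)
  case (Suc n)
  have "(b n [^] q) [^] t n = (b n [^] t n) [^] q"
    using Suc.prems by (simp add: int_pow_pow mult.commute flip: int_pow_int)
  then show ?case using Suc by (simp add: pow_mult_distrib m_comm)
qed simp

lemma lincomb_unit:
  assumes "\<And>i. i < n \<Longrightarrow> b i \<in> carrier G" "j < n"
  shows "lincomb G b (\<lambda>i. if i = j then 1 else 0) n = b j"
  using assms
proof (induction n)
  case (Suc n)
  show ?case
  proof (cases "j = n")
    case True
    have "lincomb G b (\<lambda>i. if i = n then 1 else 0) n = lincomb G b (\<lambda>_. 0) n"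
      by (rule lincomb_cong) simp
    then show ?thesis using True Suc.prems lincomb_zero[of n b] by simp
  next
    case False
    then show ?thesis using Suc by simp
  qed
qed simp

text \<open>If \<open>S\<close> has exponent \<open>p\<close>, this is linear independence over the
  field of \<open>p\<close> elements, with integer coefficients that count only modulo
  \<open>p\<close>.\<close>

definition indep :: "nat \<Rightarrow> 'a set \<Rightarrow> (nat \<Rightarrow> 'a) \<Rightarrow> nat \<Rightarrow> bool" where
  "indep p S b n \<longleftrightarrow> (\<forall>i<n. b i \<in> S) \<and> (\<forall>t. lincomb G b t n = \<one> \<longrightarrow> (\<forall>i<n. int p dvd t i))"

lemma indep_unique:
  assumes "indep p S b n" "S \<subseteq> carrier G" "lincomb G b t n = lincomb G b s n" "i < n"
  shows "[t i = s i] (mod int p)"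
proof -
  have b: "b j \<in> carrier G" if "j < n" for j using assms(1,2) that unfolding indep_def by blast
  have "lincomb G b (\<lambda>i. s i + (-1) * t i) n = lincomb G b s n \<otimes> lincomb G b t n [^] (-1::int)"
    using b by (simp only: lincomb_add lincomb_int_pow)
  also have "\<dots> = \<one>" using assms(3) b by (simp add: int_pow_neg)
  finally have "int p dvd s i + (-1) * t i" using assms(1,4) unfolding indep_def by blast
  then show ?thesis by (metis cong_iff_dvd_diff cong_sym mult_minus1 uminus_add_conv_diff add.commute)
qed

lemma lincomb_mod:
  fixes p :: nat
  assumes "\<And>x. x \<in> S \<Longrightarrow> x [^] p = \<one>" "\<And>i. i < n \<Longrightarrow> b i \<in> S" "S \<subseteq> carrier G"
  shows "lincomb G b (\<lambda>i. t i mod int p) n = lincomb G b t n"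
  using assms(2)
proof (induction n)
  case (Suc n)
  have b: "b n \<in> carrier G" "b n [^] int p = \<one>" using Suc.prems assms(1,3) by (auto simp: int_pow_int)
  have "b n [^] t n = b n [^] (int p * (t n div int p) + t n mod int p)" by simp
  also have "\<dots> = (b n [^] int p) [^] (t n div int p) \<otimes> b n [^] (t n mod int p)"
    using b(1) by (simp only: int_pow_mult int_pow_pow)
  also have "\<dots> = b n [^] (t n mod int p)" using b by simp
  finally show ?case using Suc by simp
qed simp

lemma indep_inj:
  assumes "indep p S b n" "S \<subseteq> carrier G"
  shows "inj_on (\<lambda>t. lincomb G b t n) (PiE {..<n} (\<lambda>_. {0..<int p}))"
proof (rule inj_onI)
  fix t s assume ts: "t \<in> PiE {..<n} (\<lambda>_. {0..<int p})" "s \<in> PiE {..<n} (\<lambda>_. {0..<int p})"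
    and eq: "lincomb G b t n = lincomb G b s n"
  show "t = s"
  proof (rule PiE_ext[OF ts])
    fix i assume i: "i \<in> {..<n}"
    then have "[t i = s i] (mod int p)" using indep_unique[OF assms eq] by simp
    then show "t i = s i"
      using PiE_mem[OF ts(1) i] PiE_mem[OF ts(2) i] by (simp add: cong_def)
  qed
qed

lemma indep_card_le:
  assumes "finite (carrier G)" "subgroup S G" "indep p S b n"
  shows "p ^ n \<le> card S"
proof -
  have S: "S \<subseteq> carrier G" using assms(2) subgroup.subset by blast
  have "p ^ n = card ((\<lambda>t. lincomb G b t n) ` PiE {..<n} (\<lambda>_. {0..<int p}))"
    using card_image[OF indep_inj[OF assms(3) S]] by (simp add: card_PiE)
  also have "\<dots> \<le> card S"
    using assms S lincomb_in_subgroup[OF assms(2)] unfolding indep_def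
    by (intro card_mono) (auto intro: finite_subset)
  finally show ?thesis .
qed

lemma indep_spanning_card:
  assumes "subgroup S G" "indep p S b n" "0 < p"
    and exponent: "\<And>x. x \<in> S \<Longrightarrow> x [^] p = \<one>"
    and span: "\<And>x. x \<in> S \<Longrightarrow> \<exists>t. x = lincomb G b t n"
  shows "card S = p ^ n"
proof -
  have S: "S \<subseteq> carrier G" using assms(1) subgroup.subset by blast
  have b: "b i \<in> S" if "i < n" for i using assms(2) that unfolding indep_def by blast
  have "S \<subseteq> (\<lambda>t. lincomb G b t n) ` PiE {..<n} (\<lambda>_. {0..<int p})"
  proof
    fix x assume x: "x \<in> S"
    then obtain t where t: "x = lincomb G b t n" using span by blast
    have "lincomb G b (\<lambda>i\<in>{..<n}. t i mod int p) n = lincomb G b (\<lambda>i. t i mod int p) n"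
      by (rule lincomb_cong) simp
    also have "\<dots> = x" unfolding t by (rule lincomb_mod[OF exponent b S])
    finally show "x \<in> (\<lambda>t. lincomb G b t n) ` PiE {..<n} (\<lambda>_. {0..<int p})"
      using \<open>0 < p\<close> by (intro image_eqI[of _ _ "\<lambda>i\<in>{..<n}. t i mod int p"]) auto
  qed
  then have "S = (\<lambda>t. lincomb G b t n) ` PiE {..<n} (\<lambda>_. {0..<int p})"
    using lincomb_in_subgroup[OF assms(1)] b by blast
  then show ?thesis
    using card_image[OF indep_inj[OF assms(2) S]] by (simp add: card_PiE)
qed

text \<open>In a relation among the \<open>b i\<close> and \<open>x\<close>, an exponent of
  \<open>x\<close> prime to \<open>p\<close> could be inverted modulo \<open>p\<close>, which would
  express \<open>x\<close> through the \<open>b i\<close>. So it is divisible by \<open>p\<close>,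
  \<open>x\<close> drops out, and the independence of \<open>b\<close> applies.\<close>

lemma indep_extend_one:
  assumes p: "Factorial_Ring.prime p" and "subgroup S G" "indep p S b n"
    and exponent: "\<And>x. x \<in> S \<Longrightarrow> x [^] p = \<one>"
    and x: "x \<in> S" "\<nexists>t. x = lincomb G b t n"
  shows "indep p S (b(n := x)) (Suc n)"
  unfolding indep_def
proof (intro conjI allI impI)
  have S: "S \<subseteq> carrier G" using assms(2) subgroup.subset by blast
  have b: "b i \<in> S" "b i \<in> carrier G" if "i < n" for i using assms(3) S that unfolding indep_def by blast+
  show "(b(n := x)) i \<in> S" if "i < Suc n" for i using that x b by auto
  fix t i assume "lincomb G (b(n := x)) t (Suc n) = \<one>" and i: "i < Suc n"
  moreover have "lincomb G (b(n := x)) t n = lincomb G b t n" by (rule lincomb_cong) simp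
  ultimately have rel: "lincomb G b t n \<otimes> x [^] t n = \<one>" by simp
  have xc: "x \<in> carrier G" using x S by blast
  have xp: "x [^] int p = \<one>" using exponent x by (simp add: int_pow_int)
  have tn: "int p dvd t n"
  proof (rule ccontr)
    assume "\<not> int p dvd t n"
    then have "coprime (t n) (int p)" using p by (metis coprime_commute prime_imp_coprime prime_int_nat_transfer prime_nat_int_transfer)
    then obtain u where "[t n * u = 1] (mod int p)" using cong_solve_coprime_int by blast
    then obtain v where v: "1 = t n * u + int p * v"
      by (metis cong_iff_lin)
    have "x = x [^] (t n * u + int p * v)" using xc v by (metis int_pow_1)
    also have "\<dots> = (x [^] t n) [^] u \<otimes> (x [^] int p) [^] v"
      using xc by (simp only: int_pow_mult int_pow_pow)
    also have "\<dots> = (x [^] t n) [^] u" using xp xc by simp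
    also have "x [^] t n = inv (lincomb G b t n)"
      using rel xc b by (intro inv_equality[symmetric]) (simp_all add: m_comm)
    also have "\<dots> = lincomb G b t n [^] (-1 :: int)" using b by (simp add: int_pow_neg)
    finally have "x = lincomb G b (\<lambda>i. u * (-1 * t i)) n"
      using b by (simp only: lincomb_int_pow)
    with x show False by blast
  qed
  then obtain v where "t n = int p * v" by (elim dvdE)
  then have "x [^] t n = (x [^] int p) [^] v" using xc by (simp only: int_pow_pow)
  then have "lincomb G b t n = \<one>" using rel xp b by simp
  then show "int p dvd t i" using tn i assms(3) unfolding indep_def by (metis less_Suc_eq)
qed

text \<open>An independent continuation of \<open>c\<close> of maximal length spans, and lengths are
  bounded because \<open>n \<le> p ^ n \<le> card S\<close>.\<close>

lemma indep_extend_to_basis: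
  assumes p: "Factorial_Ring.prime p" and "finite (carrier G)" "subgroup S G"
    and exponent: "\<And>x. x \<in> S \<Longrightarrow> x [^] p = \<one>"
    and "indep p S c k"
  shows "\<exists>b n. k \<le> n \<and> (\<forall>i<k. b i = c i) \<and> indep p S b n \<and> (\<forall>x\<in>S. \<exists>t. x = lincomb G b t n)"
proof -
  define P where "P n \<longleftrightarrow> (\<exists>b. k \<le> n \<and> (\<forall>i<k. b i = c i) \<and> indep p S b n)" for n
  have "n \<le> card S" if "P n" for n
  proof -
    have "n \<le> p ^ n" using prime_gt_1_nat[OF p] by (simp add: less_exp order_less_imp_le power_gt_expt)
    then show ?thesis using that indep_card_le assms(2,3) unfolding P_def by (meson order_trans)
  qed
  moreover have "P k" unfolding P_def using assms(5) by blast
  ultimately obtain n where n: "P n" and max: "\<And>m. P m \<Longrightarrow> m \<le> n"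
    using ex_has_greatest_nat[of P k "\<lambda>x. x" "card S"] by force
  then obtain b where b: "k \<le> n" "\<forall>i<k. b i = c i" "indep p S b n" unfolding P_def by blast
  have "\<exists>t. x = lincomb G b t n" if "x \<in> S" for x
  proof (rule ccontr)
    assume "\<not> ?thesis"
    then have "indep p S (b(n := x)) (Suc n)"
      using indep_extend_one[OF p assms(3) b(3) exponent that] by blast
    then have "P (Suc n)" unfolding P_def using b by (intro exI[of _ "b(n := x)"]) auto
    then show False using max by fastforce
  qed
  with b show ?thesis by blast
qed

corollary exists_basis:
  assumes "Factorial_Ring.prime p" "finite (carrier G)" "subgroup S G" "\<And>x. x \<in> S \<Longrightarrow> x [^] p = \<one>"
  obtains b n where "indep p S b n" "\<And>x. x \<in> S \<Longrightarrow> \<exists>t. x = lincomb G b t n"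
proof -
  have "indep p S (\<lambda>_. \<one>) 0" unfolding indep_def by simp
  then show ?thesis using indep_extend_to_basis[OF assms] that by metis
qed

end

lemma hom_lincomb:
  assumes "comm_group G" "comm_group H" "h \<in> hom G H"
  shows "(\<And>i. i < n \<Longrightarrow> b i \<in> carrier G) \<Longrightarrow> h (lincomb G b t n) = lincomb H (\<lambda>i. h (b i)) t n"
proof (induction n)
  interpret G: comm_group G by fact
  interpret H: comm_group H by fact
  case 0
  then show ?case using hom_one[OF assms(3)] G.is_group H.is_group by simp
next
  interpret G: comm_group G by fact
  interpret H: comm_group H by fact
  case (Suc n)
  then show ?case
    using hom_mult[OF assms(3)] hom_int_pow[OF assms(3) _ G.is_group H.is_group] by simp
qed

text \<open>If \<open>p q\<close> is the exponent of \<open>Q\<close>, then \<open>(x\<^sup>q, y\<^sup>q) \<mapsto> \<beta> (x\<^sup>q) y\<close> is a well-defined alternating form on the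
  elementary abelian group \<open>Q\<^sup>q\<close>, with values in the elements of order dividing \<open>p\<close>.  Projecting these
  onto \<open>N\<close> gives a space of forms of dimension \<open>dim N\<close>, all but zero nondegenerate.\<close>

theorem alternating_pairing_bound:
  fixes p :: nat
  assumes p: "Factorial_Ring.prime p"
    and Q: "comm_group Q" "finite (carrier Q)" "card (carrier Q) = p ^ m" "carrier Q \<noteq> {\<one>\<^bsub>Q\<^esub>}"
    and A: "comm_group A" "finite (carrier A)"
    and homr: "\<And>x. x \<in> carrier Q \<Longrightarrow> \<beta> x \<in> hom Q A"
    and homl: "\<And>y. y \<in> carrier Q \<Longrightarrow> (\<lambda>x. \<beta> x y) \<in> hom Q A"
    and alt: "\<And>x. x \<in> carrier Q \<Longrightarrow> \<beta> x x = \<one>\<^bsub>A\<^esub>"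
    and N: "subgroup N A"
    and onto: "\<And>x a. \<lbrakk>x \<in> carrier Q; x \<noteq> \<one>\<^bsub>Q\<^esub>; a \<in> N\<rbrakk> \<Longrightarrow> \<exists>y\<in>carrier Q. \<beta> x y = a"
  shows "card N ^ 2 \<le> card (carrier Q)"
proof -
  interpret Q: comm_group Q by fact
  interpret A: comm_group A by fact
  have p0: "0 < p" using p prime_gt_0_nat by blast
  have closed: "\<beta> x y \<in> carrier A" if "x \<in> carrier Q" "y \<in> carrier Q" for x y
    using homr[OF that(1)] that(2) by (auto simp: hom_def)
  have powr: "\<beta> x (y [^]\<^bsub>Q\<^esub> (n::nat)) = \<beta> x y [^]\<^bsub>A\<^esub> n" if "x \<in> carrier Q" "y \<in> carrier Q" for x y n
    using hom_int_pow[OF homr[OF that(1)] that(2) Q.is_group A.is_group, of "int n"] by (simp add: int_pow_int)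
  have powl: "\<beta> (x [^]\<^bsub>Q\<^esub> (n::nat)) y = \<beta> x y [^]\<^bsub>A\<^esub> n" if "x \<in> carrier Q" "y \<in> carrier Q" for x y n
    using hom_int_pow[OF homl[OF that(2)] that(1) Q.is_group A.is_group, of "int n"] by (simp add: int_pow_int)
  have onel: "\<beta> \<one>\<^bsub>Q\<^esub> y = \<one>\<^bsub>A\<^esub>" if "y \<in> carrier Q" for y
    using hom_one[OF homl[OF that] Q.is_group A.is_group] .
  have anti: "\<beta> x y \<otimes>\<^bsub>A\<^esub> \<beta> y x = \<one>\<^bsub>A\<^esub>" if "x \<in> carrier Q" "y \<in> carrier Q" for x y
  proof -
    have "\<beta> (x \<otimes>\<^bsub>Q\<^esub> y) (x \<otimes>\<^bsub>Q\<^esub> y) = (\<beta> x x \<otimes>\<^bsub>A\<^esub> \<beta> x y) \<otimes>\<^bsub>A\<^esub> (\<beta> y x \<otimes>\<^bsub>A\<^esub> \<beta> y y)"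
      using hom_mult[OF homl, of "x \<otimes>\<^bsub>Q\<^esub> y" x y] hom_mult[OF homr] that by simp
    then show ?thesis using alt that closed by simp
  qed

  have fin_exp: "\<exists>e. \<forall>x\<in>carrier Q. x [^]\<^bsub>Q\<^esub> (p ^ e) = \<one>\<^bsub>Q\<^esub>"
    using Q.pow_order_eq_1 Q(3) by (intro exI[of _ m]) (simp add: Coset.order_def)
  \<comment> \<open>The exponent of \<open>Q\<close> is \<open>p ^ e\<close> with
    \<open>e > 0\<close>. For \<open>q = p ^ (e - 1)\<close> the group \<open>W\<close> of
    \<open>q\<close>-th powers is therefore nontrivial, while every element of it has order dividing
    \<open>p\<close>.\<close>
  define e where "e = (LEAST e. \<forall>x\<in>carrier Q. x [^]\<^bsub>Q\<^esub> (p ^ e) = \<one>\<^bsub>Q\<^esub>)"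
  have e: "\<forall>x\<in>carrier Q. x [^]\<^bsub>Q\<^esub> (p ^ e) = \<one>\<^bsub>Q\<^esub>"
    unfolding e_def by (rule LeastI_ex[OF fin_exp])
  have "e \<noteq> 0"
  proof
    assume "e = 0"
    with e have "\<forall>x\<in>carrier Q. x = \<one>\<^bsub>Q\<^esub>" by simp
    with Q(4) show False by blast
  qed
  then obtain e' where e': "e = Suc e'" by (cases e) auto
  define q where "q = p ^ e'"
  have qp: "(x [^]\<^bsub>Q\<^esub> q) [^]\<^bsub>Q\<^esub> p = \<one>\<^bsub>Q\<^esub>" if "x \<in> carrier Q" for x
    using e e' that by (simp add: Q.nat_pow_pow q_def mult.commute)
  obtain u0 where u0: "u0 \<in> carrier Q" "u0 [^]\<^bsub>Q\<^esub> q \<noteq> \<one>\<^bsub>Q\<^esub>"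
    using not_less_Least[of e' "\<lambda>e. \<forall>x\<in>carrier Q. x [^]\<^bsub>Q\<^esub> (p ^ e) = \<one>\<^bsub>Q\<^esub>"] e' e_def q_def by auto

  define W where "W = (\<lambda>x. x [^]\<^bsub>Q\<^esub> q) ` carrier Q"
  have W: "subgroup W Q"
  proof (rule Q.subgroupI)
    show "W \<subseteq> carrier Q" "W \<noteq> {}" unfolding W_def by auto
    show "inv\<^bsub>Q\<^esub> a \<in> W" if "a \<in> W" for a
      using that unfolding W_def by (auto simp: Q.nat_pow_inv[symmetric])
    show "a \<otimes>\<^bsub>Q\<^esub> b \<in> W" if "a \<in> W" "b \<in> W" for a b
      using that unfolding W_def
      by (auto simp: Q.nat_pow_distrib[symmetric])
  qed
  have Wp: "x [^]\<^bsub>Q\<^esub> p = \<one>\<^bsub>Q\<^esub>" if "x \<in> W" for x using that qp unfolding W_def by auto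
  obtain w r where wr: "Q.indep p W w r" "\<And>x. x \<in> W \<Longrightarrow> \<exists>t. x = lincomb Q w t r"
    using Q.exists_basis[OF p Q(2) W Wp] by blast
  have wW: "w l \<in> W" if "l < r" for l using wr(1) that unfolding Q.indep_def by blast
  \<comment> \<open>Chosen \<open>q\<close>-th roots of the basis elements of \<open>W\<close>: the
    matrix of a form has its entries read off at the pairs \<open>w l\<close>,
    \<open>y j\<close>.\<close>
  then have "\<forall>l. \<exists>x. l < r \<longrightarrow> x \<in> carrier Q \<and> w l = x [^]\<^bsub>Q\<^esub> q" unfolding W_def by blast
  then obtain y where y: "\<And>l. l < r \<Longrightarrow> y l \<in> carrier Q" "\<And>l. l < r \<Longrightarrow> w l = y l [^]\<^bsub>Q\<^esub> q"
    by metis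
  have wQ: "w l \<in> carrier Q" if "l < r" for l using y that by simp
  have "0 < r"
  proof (rule ccontr)
    assume "\<not> 0 < r"
    with wr(2)[of "u0 [^]\<^bsub>Q\<^esub> q"] u0 show False unfolding W_def by auto
  qed

  define E where "E = {a \<in> carrier A. a [^]\<^bsub>A\<^esub> p = \<one>\<^bsub>A\<^esub>}"
  have E: "subgroup E A"
    by (rule A.subgroupI) (auto simp: E_def A.nat_pow_inv A.nat_pow_distrib)
  have Ep: "a [^]\<^bsub>A\<^esub> p = \<one>\<^bsub>A\<^esub>" "a \<in> carrier A" if "a \<in> E" for a using that unfolding E_def by auto
  have EA: "E \<subseteq> carrier A" unfolding E_def by blast
  have WE: "\<beta> x z \<in> E" if "x \<in> W" "z \<in> carrier Q" for x z
  proof -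
    have x: "x \<in> carrier Q" using that(1) W subgroup.mem_carrier by metis
    have "\<beta> x z [^]\<^bsub>A\<^esub> p = \<beta> (x [^]\<^bsub>Q\<^esub> p) z" using powl x that(2) by simp
    then show ?thesis using Wp[OF that(1)] onel x that(2) closed unfolding E_def by simp
  qed
  \<comment> \<open>By \<open>onto\<close>, every element of \<open>N\<close> is a value of
    \<open>\<beta>\<close> at the one nontrivial element \<open>u0 [^] q\<close> of
    \<open>W\<close>, and such values have order dividing \<open>p\<close>.\<close>
  have NE: "N \<subseteq> E"
  proof
    fix a assume "a \<in> N"
    then obtain z where "z \<in> carrier Q" "\<beta> (u0 [^]\<^bsub>Q\<^esub> q) z = a" using onto u0 by blast
    moreover have "u0 [^]\<^bsub>Q\<^esub> q \<in> W" using u0 unfolding W_def by blast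
    ultimately show "a \<in> E" using WE by blast
  qed
  have Np: "a [^]\<^bsub>A\<^esub> p = \<one>\<^bsub>A\<^esub>" if "a \<in> N" for a using NE Ep that by blast
  obtain c k where ck: "A.indep p N c k" "\<And>x. x \<in> N \<Longrightarrow> \<exists>t. x = lincomb A c t k"
    using A.exists_basis[OF p A(2) N Np] by blast
  have cE: "A.indep p E c k" using ck(1) NE unfolding A.indep_def by blast
  \<comment> \<open>A basis of \<open>E\<close> that begins with a basis of \<open>N\<close>: the
    first \<open>k\<close> coordinates are the projection to \<open>N\<close>.\<close>
  obtain b s where b: "k \<le> s" "\<forall>i<k. b i = c i" "A.indep p E b s"
    "\<forall>x\<in>E. \<exists>t. x = lincomb A b t s"
    using A.indep_extend_to_basis[OF p A(2) E Ep(1) cE] by blast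
  have bE: "b i \<in> E" if "i < s" for i using b(3) that unfolding A.indep_def by blast
  have bA: "b i \<in> carrier A" if "i < s" for i using bE[OF that] Ep by blast

  \<comment> \<open>Integer coordinates picked arbitrarily, hence meaningful only modulo
    \<open>p\<close>.\<close>
  define \<tau> where "\<tau> a = (SOME t. a = lincomb A b t s)" for a
  have \<tau>: "lincomb A b (\<tau> a) s = a" if "a \<in> E" for a
    unfolding \<tau>_def using someI_ex[OF bspec[OF b(4) that]] by simp
  have \<tau>_eq: "[\<tau> a i = t i] (mod int p)" if "a \<in> E" "a = lincomb A b t s" "i < s" for a t i
    using A.indep_unique[OF b(3) EA _ that(3)] \<tau>[OF that(1)] that(2) by simp
  \<comment> \<open>Only the entries with \<open>l < j\<close> are read off from
    \<open>\<beta>\<close>. The others are filled in, because the Pfaffian argument asks for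
    antisymmetry over the integers and \<open>\<tau>\<close> would give it only modulo
    \<open>p\<close>.\<close>
  define a where "a i l j = (if l < j then \<tau> (\<beta> (w l) (y j)) i
      else if j < l then - \<tau> (\<beta> (w j) (y l)) i else 0)" for i l j
  have a: "[a i l j = \<tau> (\<beta> (w l) (y j)) i] (mod int p)" if "i < s" "l < r" "j < r" for i l j
  proof -
    consider "l < j" | "j < l" | "l = j" by linarith
    then show ?thesis
    proof cases
      case 2
      have in_E: "\<beta> (w l) (y j) \<in> E" "\<beta> (w j) (y l) \<in> E" using WE wW y that by auto
      \<comment> \<open>Taking \<open>q\<close> out of the first argument restores the symmetry
        between the two arguments, so the antisymmetry of \<open>\<beta>\<close> carries over to the
        form.\<close>
      have "\<beta> (w l) (y j) \<otimes>\<^bsub>A\<^esub> \<beta> (w j) (y l) = (\<beta> (y l) (y j) \<otimes>\<^bsub>A\<^esub> \<beta> (y j) (y l)) [^]\<^bsub>A\<^esub> q"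
        using that y powl closed by (simp add: A.nat_pow_distrib)
      also have "\<dots> = \<one>\<^bsub>A\<^esub>" using anti y that by simp
      finally have "\<beta> (w j) (y l) = inv\<^bsub>A\<^esub> (\<beta> (w l) (y j))"
        using in_E Ep(2) by (metis A.inv_equality A.m_comm)
      also have "\<dots> = lincomb A b (\<tau> (\<beta> (w l) (y j))) s [^]\<^bsub>A\<^esub> (-1 :: int)"
        using \<tau> in_E Ep(2) by (simp add: A.int_pow_neg)
      finally have "\<beta> (w j) (y l) = lincomb A b (\<lambda>i. -1 * \<tau> (\<beta> (w l) (y j)) i) s"
        using bA by (simp only: A.lincomb_int_pow)
      from \<tau>_eq[OF in_E(2) this that(1)] have "[\<tau> (\<beta> (w j) (y l)) i = - \<tau> (\<beta> (w l) (y j)) i] (mod int p)"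
        by simp
      then have "[- \<tau> (\<beta> (w j) (y l)) i = \<tau> (\<beta> (w l) (y j)) i] (mod int p)"
        by (metis cong_minus_minus_iff minus_minus)
      then show ?thesis using 2 unfolding a_def by simp
    next
      case 3
      have "\<beta> (w l) (y j) = \<one>\<^bsub>A\<^esub>" using 3 that y powl alt by simp
      then have "\<beta> (w l) (y j) = lincomb A b (\<lambda>_. 0) s" using A.lincomb_zero[of s b] bA by simp
      moreover have "\<beta> (w l) (y j) \<in> E" using WE wW y that by auto
      ultimately have "[\<tau> (\<beta> (w l) (y j)) i = 0] (mod int p)" using \<tau>_eq[of _ "\<lambda>_. 0"] that(1) by blast
      then show ?thesis using 3 unfolding a_def by (simp add: cong_sym)
    qed (simp add: a_def)
  qed

  have "2 * k \<le> r"
  proof (rule nondegenerate_alternating_forms_bound[OF p \<open>0 < r\<close>])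
    show "a i l j = - a i j l" for i l j unfolding a_def by simp
    fix t x :: "nat \<Rightarrow> int"
    assume "\<exists>i<k. \<not> int p dvd t i" and x: "\<exists>l<r. \<not> int p dvd x l"
    then obtain i0 where i0: "i0 < k" "\<not> int p dvd t i0" by blast
    \<comment> \<open>A linear functional on \<open>E\<close> modulo \<open>p\<close>, taking the
      value \<open>t i0\<close> at \<open>b i0\<close>, which lies in \<open>N\<close>. Composed
      with \<open>\<beta>\<close> it is the form with parameter \<open>t\<close>.\<close>
    define \<phi> where "\<phi> a = (\<Sum>i<k. t i * \<tau> a i)" for a
    have \<phi>_eq: "[\<phi> a = (\<Sum>i<k. t i * \<tau>' i)] (mod int p)" if "a \<in> E" "a = lincomb A b \<tau>' s" for a \<tau>'
      unfolding \<phi>_def by (intro cong_sum cong_mult cong_refl \<tau>_eq[OF that]) (use b(1) in simp)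
    have \<phi>_lincomb: "[\<phi> (lincomb A f z n) = (\<Sum>l<n. z l * \<phi> (f l))] (mod int p)"
      if "\<And>l. l < n \<Longrightarrow> f l \<in> E" for f z n
      using that
    proof (induction n)
      case 0
      have "[\<phi> \<one>\<^bsub>A\<^esub> = (\<Sum>i<k. t i * 0)] (mod int p)"
        by (rule \<phi>_eq) (use E subgroup.one_closed A.lincomb_zero[of s b] bA in auto)
      then show ?case by simp
    next
      case (Suc n)
      let ?g = "lincomb A f z n"
      have g: "?g \<in> E" using A.lincomb_in_subgroup[OF E] Suc.prems by simp
      have fn: "f n \<in> E" using Suc.prems by simp
      have "lincomb A b (\<lambda>i. \<tau> ?g i + z n * \<tau> (f n) i) s
          = lincomb A b (\<tau> ?g) s \<otimes>\<^bsub>A\<^esub> lincomb A b (\<tau> (f n)) s [^]\<^bsub>A\<^esub> z n"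
        using bA by (simp only: A.lincomb_add A.lincomb_int_pow)
      then have eq: "lincomb A f z (Suc n) = lincomb A b (\<lambda>i. \<tau> ?g i + z n * \<tau> (f n) i) s"
        using \<tau> g fn by simp
      have "lincomb A f z (Suc n) \<in> E" using A.lincomb_in_subgroup[OF E, of "Suc n"] Suc.prems by blast
      from \<phi>_eq[OF this eq] have "[\<phi> (lincomb A f z (Suc n)) = \<phi> ?g + z n * \<phi> (f n)] (mod int p)"
        by (simp add: \<phi>_def algebra_simps sum.distrib sum_distrib_left)
      also have "[\<phi> ?g + z n * \<phi> (f n) = (\<Sum>l<n. z l * \<phi> (f l)) + z n * \<phi> (f n)] (mod int p)"
        by (intro cong_add cong_refl Suc.IH) (use Suc.prems in auto)
      finally show ?case by simp
    qed

    define v where "v = lincomb Q w x r"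
    define u where "u = lincomb Q y x r"
    have u: "u \<in> carrier Q" unfolding u_def using y by simp
    have vu: "v = u [^]\<^bsub>Q\<^esub> q"
      unfolding v_def u_def using Q.lincomb_base_pow[of r y q x] y lincomb_cong[of r w "\<lambda>l. y l [^]\<^bsub>Q\<^esub> q" x x Q] by simp
    have vW: "v \<in> W" and v: "v \<in> carrier Q" using vu u unfolding W_def by auto
    have "v \<noteq> \<one>\<^bsub>Q\<^esub>" using wr(1) x unfolding v_def Q.indep_def by blast
    moreover have "b i0 \<in> N" using b(2) i0 ck(1) unfolding A.indep_def by simp
    ultimately obtain z where z: "z \<in> carrier Q" "\<beta> v z = b i0" using onto v by blast
    \<comment> \<open>The element \<open>z\<close> need not be a combination of the
      \<open>y j\<close>, but its \<open>q\<close>-th power is one of the \<open>w j\<close>. Since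
      \<open>v\<close> is the \<open>q\<close>-th power of \<open>u\<close>, the exponent can be
      carried across the pairing and back, so \<open>b i0\<close> is a combination of the values
      \<open>\<beta> v (y j)\<close>.\<close>
    obtain \<sigma> where \<sigma>: "z [^]\<^bsub>Q\<^esub> q = lincomb Q w \<sigma> r" using wr(2) z(1) unfolding W_def by blast
    have "\<beta> v z = \<beta> u (z [^]\<^bsub>Q\<^esub> q)" unfolding vu using powl powr u z(1) by simp
    also have "\<dots> = lincomb A (\<lambda>j. \<beta> u (w j)) \<sigma> r"
      unfolding \<sigma> by (rule hom_lincomb[OF Q(1) A(1) homr[OF u]]) (rule wQ)
    also have "\<dots> = lincomb A (\<lambda>j. \<beta> v (y j)) \<sigma> r"
    proof (rule lincomb_cong)
      fix j assume "j < r"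
      then show "\<beta> u (w j) = \<beta> v (y j) \<and> \<sigma> j = \<sigma> j" unfolding vu using powl powr u y by simp
    qed
    finally have bi0: "b i0 = lincomb A (\<lambda>j. \<beta> v (y j)) \<sigma> r" using z by simp
    have comb: "[\<phi> (\<beta> v (y j)) = (\<Sum>l<r. x l * (\<Sum>i<k. t i * a i l j))] (mod int p)" if j: "j < r" for j
    proof -
      have "\<beta> v (y j) = lincomb A (\<lambda>l. \<beta> (w l) (y j)) x r"
        unfolding v_def by (rule hom_lincomb[OF Q(1) A(1) homl[OF y(1)[OF j]]]) (rule wQ)
      then have "[\<phi> (\<beta> v (y j)) = (\<Sum>l<r. x l * \<phi> (\<beta> (w l) (y j)))] (mod int p)"
        using \<phi>_lincomb[of r "\<lambda>l. \<beta> (w l) (y j)" x] WE wW y j by simp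
      also have "[(\<Sum>l<r. x l * \<phi> (\<beta> (w l) (y j))) = (\<Sum>l<r. x l * (\<Sum>i<k. t i * a i l j))] (mod int p)"
        unfolding \<phi>_def
        by (intro cong_sum cong_mult cong_refl cong_sym[OF a]) (use j b(1) in auto)
      finally show ?thesis .
    qed
    show "\<exists>j<r. \<not> int p dvd (\<Sum>l<r. x l * (\<Sum>i<k. t i * a i l j))"
    proof (rule ccontr)
      assume "\<not> ?thesis"
      then have zero: "int p dvd \<phi> (\<beta> v (y j))" if "j < r" for j
        unfolding cong_dvd_iff[OF comb[OF that]] using that by blast
      have "[\<phi> (b i0) = (\<Sum>j<r. \<sigma> j * \<phi> (\<beta> v (y j)))] (mod int p)"
        unfolding bi0 by (rule \<phi>_lincomb) (use WE vW y in auto)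
      moreover have "int p dvd (\<Sum>j<r. \<sigma> j * \<phi> (\<beta> v (y j)))"
        by (intro dvd_sum dvd_mult zero) simp
      ultimately have "int p dvd \<phi> (b i0)" using cong_dvd_iff by blast
      moreover have "[\<phi> (b i0) = (\<Sum>i<k. t i * (if i = i0 then 1 else 0))] (mod int p)"
        by (rule \<phi>_eq) (use bE bA A.lincomb_unit[of s b i0] i0 b(1) in auto)
      moreover have "(\<Sum>i<k. t i * (if i = i0 then 1 else 0)) = t i0"
        using i0 by (simp add: if_distrib cong: if_cong)
      ultimately show False using i0(2) cong_dvd_iff by force
    qed
  qed
  then have "p ^ (2 * k) \<le> p ^ r" using p0 by (intro power_increasing) auto
  moreover have "card N = p ^ k" by (rule A.indep_spanning_card[OF N ck(1) p0 Np ck(2)])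
  moreover have "p ^ r \<le> card W" by (rule Q.indep_card_le[OF Q(2) W wr(1)])
  moreover have "card W \<le> card (carrier Q)"
    using Q(2) W subgroup.subset by (intro card_mono) auto
  ultimately show ?thesis by (simp add: power_mult[symmetric] mult.commute)
qed

section \<open>Characters separating points\<close>

lemma mat_eq_if_mult_vec_eq:
  fixes A B :: "complex mat"
  assumes "A \<in> carrier_mat m n" "B \<in> carrier_mat m n"
    and "\<And>v. v \<in> carrier_vec n \<Longrightarrow> A *\<^sub>v v = B *\<^sub>v v"
  shows "A = B"
proof (rule eq_matI)
  fix i j assume ij: "i < dim_row B" "j < dim_col B"
  have "C $$ (i, j) = (C *\<^sub>v unit_vec n j) $ i" if "C \<in> carrier_mat m n" for C :: "complex mat"
    using that ij assms(2) scalar_prod_right_unit[of j n "row C i"] by auto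
  then show "A $$ (i, j) = B $$ (i, j)" using assms by simp
qed (use assms in auto)

lemma minus_eq_zero_vec:
  fixes w x :: "complex vec"
  assumes "w \<in> carrier_vec d" "x \<in> carrier_vec d" "w + (-1) \<cdot>\<^sub>v x = 0\<^sub>v d"
  shows "x = w"
proof (rule eq_vecI)
  fix i assume "i < dim_vec w"
  then show "x $ i = w $ i" using arg_cong[OF assms(3), of "\<lambda>v. v $ i"] assms(1,2) by simp
qed (use assms in auto)

section \<open>Conjugate transposes, isometries and orthonormal bases\<close>

definition adj :: "complex mat \<Rightarrow> complex mat" where
  "adj A = mat (dim_col A) (dim_row A) (\<lambda>(i, j). cnj (A $$ (j, i)))"

lemma adj_carrier [simp]: "A \<in> carrier_mat m n \<Longrightarrow> adj A \<in> carrier_mat n m"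
  unfolding adj_def by auto

lemma adj_dim [simp]: "dim_row (adj A) = dim_col A" "dim_col (adj A) = dim_row A"
  unfolding adj_def by auto

lemma adj_adj [simp]: "adj (adj A) = A"
  unfolding adj_def by auto

lemma adj_mult:
  assumes "A \<in> carrier_mat l m" "B \<in> carrier_mat m n"
  shows "adj (A * B) = adj B * adj A"
proof (rule eq_matI)
  fix i j assume "i < dim_row (adj B * adj A)" "j < dim_col (adj B * adj A)"
  then show "adj (A * B) $$ (i, j) = (adj B * adj A) $$ (i, j)"
    using assms by (auto simp: adj_def scalar_prod_def mult.commute intro!: sum.cong)
qed (use assms in \<open>auto simp: adj_def\<close>)

lemma adj_mult_index:
  assumes "A \<in> carrier_mat m n" "i < n" "j < n"
  shows "(adj A * A) $$ (i, j) = (\<Sum>k<m. cnj (A $$ (k, i)) * A $$ (k, j))"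
  using assms by (auto simp: adj_def scalar_prod_def atLeast0LessThan intro!: sum.cong)

text \<open>If \<open>e\<close> exceeded \<open>d\<close>, zero rows would complete \<open>P\<close>
  to a square matrix \<open>R\<close> with \<open>adj R * R = 1\<^sub>m e\<close>. Then
  \<open>R * adj R\<close> is the identity too, which its zero row \<open>d\<close>
  contradicts.\<close>

lemma isometry_dim_le:
  assumes P: "P \<in> carrier_mat d e" and iso: "adj P * P = 1\<^sub>m e"
  shows "e \<le> d" and "e = d \<Longrightarrow> P * adj P = 1\<^sub>m d"
proof -
  show "P * adj P = 1\<^sub>m d" if "e = d"
    using mat_mult_left_right_inverse[of "adj P" d P] P iso that by simp
  show "e \<le> d"
  proof (rule ccontr)
    assume less: "\<not> e \<le> d"
    define R where "R = mat e e (\<lambda>(i, j). if i < d then P $$ (i, j) else 0)"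
    have R: "R \<in> carrier_mat e e" unfolding R_def by simp
    have "adj R * R = adj P * P"
    proof (rule eq_matI)
      fix i j assume "i < dim_row (adj P * P)" "j < dim_col (adj P * P)"
      then have ij: "i < e" "j < e" using P by (auto simp: adj_def)
      have "(adj R * R) $$ (i, j) = (\<Sum>k<e. cnj (R $$ (k, i)) * R $$ (k, j))"
        by (rule adj_mult_index[OF R ij])
      also have "\<dots> = (\<Sum>k<d. cnj (P $$ (k, i)) * P $$ (k, j))"
        by (rule sum.mono_neutral_cong_right) (use less ij in \<open>auto simp: R_def\<close>)
      also have "\<dots> = (adj P * P) $$ (i, j)"
        by (rule adj_mult_index[OF P ij, symmetric])
      finally show "(adj R * R) $$ (i, j) = (adj P * P) $$ (i, j)" .
    qed (use P R in \<open>auto simp: adj_def\<close>)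
    then have "R * adj R = 1\<^sub>m e"
      using mat_mult_left_right_inverse[of "adj R" e R] R iso by simp
    moreover have "(R * adj R) $$ (d, d) = 0"
      using less by (auto simp: R_def adj_def scalar_prod_def)
    ultimately show False using less by simp
  qed
qed

definition vec_subspace :: "nat \<Rightarrow> complex vec set \<Rightarrow> bool" where
  "vec_subspace d W \<longleftrightarrow> W \<subseteq> carrier_vec d \<and> 0\<^sub>v d \<in> W \<and>
     (\<forall>v\<in>W. \<forall>w\<in>W. v + w \<in> W) \<and> (\<forall>c::complex. \<forall>v\<in>W. c \<cdot>\<^sub>v v \<in> W)"

text \<open>One Gram-Schmidt step. The formula for \<open>P'\<close> shows that its image stays in
  any subspace containing \<open>u\<close> and the image of \<open>P\<close>.\<close>

lemma append_orthonormal_column: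
  assumes P: "P \<in> carrier_mat d e" "adj P * P = 1\<^sub>m e"
    and u: "u \<in> carrier_vec d" "adj P *\<^sub>v u = 0\<^sub>v e" "u \<noteq> 0\<^sub>v d"
  obtains P' c where "P' \<in> carrier_mat d (Suc e)" "adj P' * P' = 1\<^sub>m (Suc e)"
    "\<And>v. v \<in> carrier_vec (Suc e) \<Longrightarrow>
       P' *\<^sub>v v = P *\<^sub>v vec e (\<lambda>i. v $ i) + (c * v $ e) \<cdot>\<^sub>v u"
proof -
  define s where "s = (\<Sum>k<d. (cmod (u $ k))\<^sup>2)"
  obtain k0 where k0: "k0 < d" "u $ k0 \<noteq> 0" using u(1,3) by (metis carrier_vecD eq_vecI index_zero_vec)
  have "0 < (cmod (u $ k0))\<^sup>2" using k0 by simp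
  also have "\<dots> \<le> s" unfolding s_def by (rule member_le_sum) (use k0 in auto)
  finally have s: "0 < s" .
  define c where "c = complex_of_real (1 / sqrt s)"
  have cc: "cnj c * c * complex_of_real s = 1"
    unfolding c_def using s by (simp flip: of_real_mult add: real_sqrt_mult_self)
  define P' where "P' = mat d (Suc e) (\<lambda>(i, j). if j < e then P $$ (i, j) else c * u $ i)"
  have P': "P' \<in> carrier_mat d (Suc e)" unfolding P'_def by simp
  have orth: "(\<Sum>k<d. cnj (P $$ (k, i)) * u $ k) = 0" if "i < e" for i
  proof -
    have "(\<Sum>k<d. cnj (P $$ (k, i)) * u $ k) = (adj P *\<^sub>v u) $ i"
      using P(1) u(1) that by (auto simp: adj_def scalar_prod_def atLeast0LessThan intro!: sum.cong)
    then show ?thesis using u(2) that by simp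
  qed
  have orth': "(\<Sum>k<d. cnj (u $ k) * P $$ (k, i)) = 0" if "i < e" for i
    using arg_cong[OF orth[OF that], of cnj] by (simp add: mult.commute)
  have norm: "(\<Sum>k<d. cnj (u $ k) * u $ k) = complex_of_real s"
    unfolding s_def of_real_sum by (rule sum.cong) (simp_all add: complex_norm_square mult.commute del: of_real_power)
  have "adj P' * P' = 1\<^sub>m (Suc e)"
  proof (rule eq_matI)
    fix i j assume "i < dim_row (1\<^sub>m (Suc e))" "j < dim_col (1\<^sub>m (Suc e))"
    then have ij: "i < Suc e" "j < Suc e" by auto
    have sum: "(adj P' * P') $$ (i, j) = (\<Sum>k<d. cnj (P' $$ (k, i)) * P' $$ (k, j))"
      by (rule adj_mult_index[OF P' ij])
    consider "i < e" "j < e" | "i < e" "j = e" | "i = e" "j < e" | "i = e" "j = e" using ij by linarith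
    then show "(adj P' * P') $$ (i, j) = 1\<^sub>m (Suc e) $$ (i, j)"
    proof cases
      case 1
      have "(adj P' * P') $$ (i, j) = (adj P * P) $$ (i, j)"
        unfolding sum adj_mult_index[OF P(1) 1] by (rule sum.cong) (use 1 in \<open>auto simp: P'_def\<close>)
      then show ?thesis using P(2) 1 by simp
    next
      case 2
      have "(adj P' * P') $$ (i, j) = c * (\<Sum>k<d. cnj (P $$ (k, i)) * u $ k)"
        unfolding sum sum_distrib_left by (rule sum.cong) (use 2 in \<open>auto simp: P'_def\<close>)
      then show ?thesis using orth 2 by simp
    next
      case 3
      have "(adj P' * P') $$ (i, j) = cnj c * (\<Sum>k<d. cnj (u $ k) * P $$ (k, j))"
        unfolding sum sum_distrib_left by (rule sum.cong) (use 3 in \<open>auto simp: P'_def\<close>)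
      then show ?thesis using orth' 3 by simp
    next
      case 4
      have "(adj P' * P') $$ (i, j) = cnj c * c * (\<Sum>k<d. cnj (u $ k) * u $ k)"
        unfolding sum sum_distrib_left by (rule sum.cong) (use 4 in \<open>auto simp: P'_def\<close>)
      then show ?thesis using norm cc 4 by simp
    qed
  qed (use P' in auto)
  moreover have "P' *\<^sub>v v = P *\<^sub>v vec e (\<lambda>i. v $ i) + (c * v $ e) \<cdot>\<^sub>v u" if "v \<in> carrier_vec (Suc e)" for v
  proof (rule eq_vecI)
    fix i assume "i < dim_vec (P *\<^sub>v vec e (\<lambda>i. v $ i) + (c * v $ e) \<cdot>\<^sub>v u)"
    then have i: "i < d" using u by simp
    have "(\<Sum>j<e. (if j < e then P $$ (i, j) else c * u $ i) * v $ j) = (\<Sum>j<e. P $$ (i, j) * v $ j)"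
      by (rule sum.cong) auto
    then show "(P' *\<^sub>v v) $ i = (P *\<^sub>v vec e (\<lambda>i. v $ i) + (c * v $ e) \<cdot>\<^sub>v u) $ i"
      using i P u that
      by (simp add: P'_def scalar_prod_def atLeast0LessThan)
  qed (use P P' u in auto)
  ultimately show ?thesis using that P' by blast
qed

text \<open>Take an isometry into \<open>W\<close> with as many columns as possible, starting from
  the matrix without columns. If some \<open>w\<close> in \<open>W\<close> differed from its
  projection, the difference would be orthogonal to all columns and could be appended after
  normalisation.\<close>

lemma orthonormal_basis_exists:
  assumes W: "vec_subspace d W"
  shows "\<exists>e P. P \<in> carrier_mat d e \<and> adj P * P = 1\<^sub>m e \<and>
    (\<forall>v\<in>carrier_vec e. P *\<^sub>v v \<in> W) \<and> (\<forall>w\<in>W. P *\<^sub>v (adj P *\<^sub>v w) = w)"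
proof -
  define Q where "Q e \<longleftrightarrow> (\<exists>P. P \<in> carrier_mat d e \<and> adj P * P = 1\<^sub>m e \<and> (\<forall>v\<in>carrier_vec e. P *\<^sub>v v \<in> W))" for e
  have "Q 0"
  proof -
    let ?P = "mat d 0 (\<lambda>_. 0) :: complex mat"
    have "?P *\<^sub>v v = 0\<^sub>v d" if "v \<in> carrier_vec 0" for v
      using that by (intro eq_vecI) (auto simp: scalar_prod_def)
    moreover have "adj ?P * ?P = 1\<^sub>m 0" by (intro eq_matI) (auto simp: adj_def)
    ultimately show ?thesis unfolding Q_def using W
      by (intro exI[of _ ?P]) (auto simp: vec_subspace_def)
  qed
  moreover have "\<forall>e. Q e \<longrightarrow> e \<le> d" unfolding Q_def using isometry_dim_le(1) by blast
  ultimately obtain e where e: "Q e" and max: "\<And>e'. Q e' \<Longrightarrow> e' \<le> e"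
    using ex_has_greatest_nat[of Q 0 "\<lambda>x. x" d] by force
  obtain P where P: "P \<in> carrier_mat d e" "adj P * P = 1\<^sub>m e" "\<forall>v\<in>carrier_vec e. P *\<^sub>v v \<in> W"
    using e unfolding Q_def by blast
  have "P *\<^sub>v (adj P *\<^sub>v w) = w" if w: "w \<in> W" for w
  proof (rule ccontr)
    assume ne: "P *\<^sub>v (adj P *\<^sub>v w) \<noteq> w"
    have wc: "w \<in> carrier_vec d" using w W unfolding vec_subspace_def by blast
    let ?a = "adj P *\<^sub>v w"
    have ac: "?a \<in> carrier_vec e" using P(1) wc by (metis adj_carrier mult_mat_vec_carrier)
    have Pa: "P *\<^sub>v ?a \<in> W" "P *\<^sub>v ?a \<in> carrier_vec d" using P ac by auto
    define u where "u = w + (-1) \<cdot>\<^sub>v (P *\<^sub>v ?a)"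
    have u: "u \<in> carrier_vec d" "u \<in> W"
      using w wc Pa W unfolding u_def vec_subspace_def by auto
    have "adj P *\<^sub>v (P *\<^sub>v ?a) = ?a"
      using assoc_mult_mat_vec[OF adj_carrier[OF P(1)] P(1) ac] P(2) ac by simp
    then have "adj P *\<^sub>v u = ?a + (-1) \<cdot>\<^sub>v ?a"
      unfolding u_def using mult_add_distrib_mat_vec[OF adj_carrier[OF P(1)] wc, of "(-1) \<cdot>\<^sub>v (P *\<^sub>v ?a)"]
        mult_mat_vec[OF adj_carrier[OF P(1)] Pa(2), of "-1"] Pa by simp
    also have "\<dots> = 0\<^sub>v e"
    proof -
      have "a + (-1) \<cdot>\<^sub>v a = 0\<^sub>v e" if "a \<in> carrier_vec e" for a :: "complex vec"
        using that by (intro eq_vecI) auto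
      then show ?thesis using ac by blast
    qed
    finally have "adj P *\<^sub>v u = 0\<^sub>v e" .
    moreover have "u \<noteq> 0\<^sub>v d"
      using ne minus_eq_zero_vec[OF wc Pa(2)] unfolding u_def by auto
    ultimately obtain P' c where P': "P' \<in> carrier_mat d (Suc e)" "adj P' * P' = 1\<^sub>m (Suc e)"
      and eq: "\<And>v. v \<in> carrier_vec (Suc e) \<Longrightarrow> P' *\<^sub>v v = P *\<^sub>v vec e (\<lambda>i. v $ i) + (c * v $ e) \<cdot>\<^sub>v u"
      using append_orthonormal_column[OF P(1,2) u(1)] by blast
    have "P' *\<^sub>v v \<in> W" if "v \<in> carrier_vec (Suc e)" for v
      unfolding eq[OF that] using W u(2) bspec[OF P(3), of "vec e (\<lambda>i. v $ i)"] unfolding vec_subspace_def by simp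
    then have "Q (Suc e)" unfolding Q_def using P' by blast
    then show False using max by fastforce
  qed
  with P show ?thesis by blast
qed

section \<open>Unitary representations and irreducible constituents\<close>

definition unitary_rep :: "('a, 'b) monoid_scheme \<Rightarrow> nat \<Rightarrow> ('a \<Rightarrow> complex mat) \<Rightarrow> bool" where
  "unitary_rep G d \<rho> \<longleftrightarrow> is_rep G d \<rho> \<and> (\<forall>g\<in>carrier G. adj (\<rho> g) * \<rho> g = 1\<^sub>m d)"

lemma invariant_subspace_vec_subspace: "invariant_subspace G d \<rho> W \<Longrightarrow> vec_subspace d W"
  unfolding invariant_subspace_def vec_subspace_def by blast

lemma (in group) unitary_rep_adj:
  assumes \<rho>: "unitary_rep G d \<rho>" and g: "g \<in> carrier G"
  shows "adj (\<rho> g) = \<rho> (inv g)"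
proof -
  have c: "\<rho> g \<in> carrier_mat d d" "\<rho> (inv g) \<in> carrier_mat d d"
    and one: "adj (\<rho> g) * \<rho> g = 1\<^sub>m d" "\<rho> \<one> = 1\<^sub>m d"
    and mult: "\<rho> (g \<otimes> inv g) = \<rho> g * \<rho> (inv g)"
    using \<rho> g inv_closed[OF g] unfolding unitary_rep_def is_rep_def by blast+
  have inv: "\<rho> g * \<rho> (inv g) = 1\<^sub>m d" using mult one(2) g by simp
  have "adj (\<rho> g) * \<rho> g * \<rho> (inv g) = adj (\<rho> g) * (\<rho> g * \<rho> (inv g))"
    by (rule assoc_mult_mat[OF adj_carrier[OF c(1)] c])
  then show ?thesis unfolding inv one(1)
    using c right_mult_one_mat[OF adj_carrier[OF c(1)]] by simp
qed

text \<open>\<open>\<sigma>\<close> is the compression of \<open>\<rho>\<close> to \<open>W\<close>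
  in orthonormal coordinates. Invariance of \<open>W\<close> gives
  \<open>\<rho> g * P = P * \<sigma> g\<close>; the relation for \<open>adj P\<close>, which makes
  the orthogonal projection equivariant, is the adjoint of this one at \<open>inv g\<close> and
  rests on unitarity.\<close>

lemma (in group) restrict_unitary_rep:
  assumes \<rho>: "unitary_rep G d \<rho>" and W: "invariant_subspace G d \<rho> W"
  shows "\<exists>e P \<sigma>. P \<in> carrier_mat d e \<and> adj P * P = 1\<^sub>m e \<and>
    (\<forall>v\<in>carrier_vec e. P *\<^sub>v v \<in> W) \<and> (\<forall>w\<in>W. P *\<^sub>v (adj P *\<^sub>v w) = w) \<and>
    unitary_rep G e \<sigma> \<and> (\<forall>g\<in>carrier G. adj P * \<rho> g = \<sigma> g * adj P)"
proof -
  obtain e P where P: "P \<in> carrier_mat d e" "adj P * P = 1\<^sub>m e"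
    "\<forall>v\<in>carrier_vec e. P *\<^sub>v v \<in> W" "\<forall>w\<in>W. P *\<^sub>v (adj P *\<^sub>v w) = w"
    using orthonormal_basis_exists[OF invariant_subspace_vec_subspace[OF W]] by blast
  note aP = adj_carrier[OF P(1)]
  have Wc: "W \<subseteq> carrier_vec d" using W unfolding invariant_subspace_def by blast
  have \<rho>c: "\<rho> g \<in> carrier_mat d d" if "g \<in> carrier G" for g
    using \<rho> that unfolding unitary_rep_def is_rep_def by blast
  define \<sigma> where "\<sigma> g = adj P * (\<rho> g * P)" for g
  have \<sigma>c: "\<sigma> g \<in> carrier_mat e e" if "g \<in> carrier G" for g
    unfolding \<sigma>_def by (rule mult_carrier_mat[OF aP mult_carrier_mat[OF \<rho>c[OF that] P(1)]])
  have inter: "\<rho> g * P = P * \<sigma> g" if g: "g \<in> carrier G" for g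
  proof (rule mat_eq_if_mult_vec_eq)
    fix v :: "complex vec" assume v: "v \<in> carrier_vec e"
    have w: "\<rho> g *\<^sub>v (P *\<^sub>v v) \<in> W" using W bspec[OF P(3) v] g unfolding invariant_subspace_def by blast
    have "P * \<sigma> g *\<^sub>v v = P *\<^sub>v (adj P *\<^sub>v (\<rho> g *\<^sub>v (P *\<^sub>v v)))"
      unfolding \<sigma>_def
      by (simp add: assoc_mult_mat_vec[OF P(1) \<sigma>c[OF g, unfolded \<sigma>_def] v]
          assoc_mult_mat_vec[OF aP mult_carrier_mat[OF \<rho>c[OF g] P(1)] v] assoc_mult_mat_vec[OF \<rho>c[OF g] P(1) v])
    also have "\<dots> = \<rho> g *\<^sub>v (P *\<^sub>v v)" by (rule bspec[OF P(4) w])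
    finally show "\<rho> g * P *\<^sub>v v = P * \<sigma> g *\<^sub>v v"
      by (simp add: assoc_mult_mat_vec[OF \<rho>c[OF g] P(1) v])
  qed (use mult_carrier_mat[OF \<rho>c[OF g] P(1)] mult_carrier_mat[OF P(1) \<sigma>c[OF g]] in auto)
  have cancel: "adj P * (P * M) = M" if "M \<in> carrier_mat e k" for M k
    using assoc_mult_mat[OF aP P(1) that] P(2) that by simp
  have "is_rep G e \<sigma>"
    unfolding is_rep_def
  proof (intro conjI ballI)
    show "\<sigma> \<one> = 1\<^sub>m e"
      using \<rho> P unfolding \<sigma>_def unitary_rep_def is_rep_def by simp
    fix g h assume gh: "g \<in> carrier G" "h \<in> carrier G"
    then show "\<sigma> g \<in> carrier_mat e e" by (simp add: \<sigma>c)
    have "\<rho> (g \<otimes> h) * P = \<rho> g * \<rho> h * P"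
      using \<rho> gh unfolding unitary_rep_def is_rep_def by simp
    also have "\<dots> = \<rho> g * (P * \<sigma> h)"
      by (simp add: assoc_mult_mat[OF \<rho>c[OF gh(1)] \<rho>c[OF gh(2)] P(1)] inter[OF gh(2)])
    also have "\<dots> = P * \<sigma> g * \<sigma> h"
      by (simp add: assoc_mult_mat[OF \<rho>c[OF gh(1)] P(1) \<sigma>c[OF gh(2)], symmetric] inter[OF gh(1)] del: assoc_mult_mat)
    also have "\<dots> = P * (\<sigma> g * \<sigma> h)"
      by (rule assoc_mult_mat[OF P(1) \<sigma>c[OF gh(1)] \<sigma>c[OF gh(2)]])
    finally show "\<sigma> (g \<otimes> h) = \<sigma> g * \<sigma> h"
      unfolding \<sigma>_def[of "g \<otimes> h"] using cancel[OF mult_carrier_mat[OF \<sigma>c[OF gh(1)] \<sigma>c[OF gh(2)]]] by simp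
  qed
  moreover have adj\<sigma>: "adj (\<sigma> g) = \<sigma> (inv g)" if g: "g \<in> carrier G" for g
    unfolding \<sigma>_def adj_mult[OF aP mult_carrier_mat[OF \<rho>c[OF g] P(1)]] adj_mult[OF \<rho>c[OF g] P(1)]
      unitary_rep_adj[OF \<rho> g] adj_adj
    by (rule assoc_mult_mat[OF aP \<rho>c[OF inv_closed[OF g]] P(1)])
  ultimately have "unitary_rep G e \<sigma>"
    unfolding unitary_rep_def is_rep_def by (metis inv_closed l_inv)
  moreover have "adj P * \<rho> g = \<sigma> g * adj P" if g: "g \<in> carrier G" for g
  proof -
    note g' = inv_closed[OF g]
    have "adj (\<rho> (inv g) * P) = adj (P * \<sigma> (inv g))" using inter[OF g'] by simp
    then show ?thesis
      unfolding adj_mult[OF \<rho>c[OF g'] P(1)] adj_mult[OF P(1) \<sigma>c[OF g']]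
        unitary_rep_adj[OF \<rho> g'] adj\<sigma>[OF g'] inv_inv[OF g] .
  qed
  ultimately show ?thesis using P by blast
qed

lemma mult_mat_zero_vec:
  fixes A :: "complex mat"
  assumes "A \<in> carrier_mat m n"
  shows "A *\<^sub>v 0\<^sub>v n = 0\<^sub>v m"
  using assms by (intro eq_vecI) auto

definition regular_rep :: "('a, 'b) monoid_scheme \<Rightarrow> (nat \<Rightarrow> 'a) \<Rightarrow> nat \<Rightarrow> 'a \<Rightarrow> complex mat" where
  "regular_rep G f N g = mat N N (\<lambda>(i, j). if f i = g \<otimes>\<^bsub>G\<^esub> f j then 1 else 0)"

lemma sum_delta_bij:
  fixes h :: "'a \<Rightarrow> complex" and N :: nat
  assumes f: "bij_betw f {..<N} C" and x: "x \<in> C"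
  shows "(\<Sum>j<N. if f j = x then h (f j) else 0) = h x"
proof -
  have "(\<Sum>j<N. if f j = x then h (f j) else 0) = (\<Sum>y\<in>C. if y = x then h y else 0)"
    by (rule sum.reindex_bij_betw[OF f])
  also have "\<dots> = h x"
  proof -
    have "finite C" using bij_betw_finite[OF f] by simp
    then show ?thesis using x by simp
  qed
  finally show ?thesis .
qed

lemma (in group) unitary_rep_regular:
  assumes f: "bij_betw f {..<N} (carrier G)"
  shows "unitary_rep G N (regular_rep G f N)"
proof -
  let ?R = "regular_rep G f N"
  have fc: "f i \<in> carrier G" if "i < N" for i using f that by (auto simp: bij_betw_def)
  have finj: "f i = f j \<longleftrightarrow> i = j" if "i < N" "j < N" for i j
    using f that by (auto simp: bij_betw_def inj_on_def)
  have R: "?R g \<in> carrier_mat N N" for g unfolding regular_rep_def by simp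
  have one: "?R \<one> = 1\<^sub>m N"
    by (rule eq_matI) (auto simp: regular_rep_def fc finj)
  have mult: "?R (g \<otimes> h) = ?R g * ?R h" if gh: "g \<in> carrier G" "h \<in> carrier G" for g h
  proof (rule eq_matI)
    fix i k assume "i < dim_row (?R g * ?R h)" "k < dim_col (?R g * ?R h)"
    then have ik: "i < N" "k < N" by (auto simp: regular_rep_def)
    have "(?R g * ?R h) $$ (i, k) = (\<Sum>j<N. (if f i = g \<otimes> f j then 1 else 0) * (if f j = h \<otimes> f k then 1 else 0))"
      using ik by (simp add: regular_rep_def scalar_prod_def atLeast0LessThan)
    also have "\<dots> = (\<Sum>j<N. if f j = h \<otimes> f k then (if f i = g \<otimes> f j then 1 else 0) else 0)"
      by (rule sum.cong) auto
    also have "\<dots> = (if f i = g \<otimes> (h \<otimes> f k) then 1 else 0)"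
      using sum_delta_bij[OF f, of "h \<otimes> f k" "\<lambda>x. if f i = g \<otimes> x then 1 else 0"] gh fc ik by simp
    finally show "?R (g \<otimes> h) $$ (i, k) = (?R g * ?R h) $$ (i, k)"
      using ik gh fc by (simp add: regular_rep_def m_assoc)
  qed (auto simp: regular_rep_def)
  have adj: "adj (?R g) = ?R (inv g)" if g: "g \<in> carrier G" for g
  proof (rule eq_matI)
    fix i j assume "i < dim_row (?R (inv g))" "j < dim_col (?R (inv g))"
    then have ij: "i < N" "j < N" by (auto simp: regular_rep_def)
    have "f j = g \<otimes> f i \<longleftrightarrow> f i = inv g \<otimes> f j"
      using inv_solve_left[OF fc[OF ij(1)] g fc[OF ij(2)]] by blast
    then show "adj (?R g) $$ (i, j) = ?R (inv g) $$ (i, j)"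
      using ij by (simp add: adj_def regular_rep_def)
  qed (auto simp: regular_rep_def)
  have "adj (?R g) * ?R g = 1\<^sub>m N" if g: "g \<in> carrier G" for g
    unfolding adj[OF g] mult[OF inv_closed[OF g] g, symmetric] by (simp add: g one)
  then show ?thesis unfolding unitary_rep_def is_rep_def using R one mult by blast
qed

text \<open>\<open>u\<close> is the indicator vector of \<open>M\<close>, and \<open>g\<close> sends
  it to the indicator vector of the coset \<open>g M\<close>. The coordinate at the identity
  distinguishes \<open>M\<close> from \<open>y M\<close>.\<close>

lemma (in group) regular_rep_separates:
  assumes f: "bij_betw f {..<N} (carrier G)" and M: "subgroup M G" and y: "y \<in> carrier G" "y \<notin> M"
  defines "u \<equiv> vec N (\<lambda>i. if f i \<in> M then 1 else 0) :: complex vec"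
  shows "\<And>m. m \<in> M \<Longrightarrow> regular_rep G f N m *\<^sub>v u = u" and "regular_rep G f N y *\<^sub>v u \<noteq> u"
proof -
  have fc: "f i \<in> carrier G" if "i < N" for i using f that by (auto simp: bij_betw_def)
  have act: "(regular_rep G f N g *\<^sub>v u) $ i = (if inv g \<otimes> f i \<in> M then 1 else 0)"
    if g: "g \<in> carrier G" and i: "i < N" for g i
  proof -
    have eq: "f i = g \<otimes> f j \<longleftrightarrow> f j = inv g \<otimes> f i" if "j < N" for j
      using inv_solve_left[OF fc[OF that] g fc[OF i]] by blast
    have "(regular_rep G f N g *\<^sub>v u) $ i = (\<Sum>j<N. (if f i = g \<otimes> f j then 1 else 0) * (if f j \<in> M then 1 else 0))"
      using i by (simp add: regular_rep_def u_def scalar_prod_def atLeast0LessThan)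
    also have "\<dots> = (\<Sum>j<N. if f j = inv g \<otimes> f i then (if f j \<in> M then 1 else 0) else 0)"
      by (rule sum.cong) (use eq in auto)
    also have "\<dots> = (if inv g \<otimes> f i \<in> M then 1 else 0)"
      using sum_delta_bij[OF f, of "inv g \<otimes> f i" "\<lambda>x. if x \<in> M then 1 else 0"] g fc i by simp
    finally show ?thesis .
  qed
  show "regular_rep G f N m *\<^sub>v u = u" if m: "m \<in> M" for m
  proof (rule eq_vecI)
    fix i assume "i < dim_vec u"
    then have i: "i < N" by (simp add: u_def)
    have mc: "m \<in> carrier G" using m M subgroup.mem_carrier by metis
    have "inv m \<otimes> f i \<in> M \<longleftrightarrow> f i \<in> M"
    proof
      assume "inv m \<otimes> f i \<in> M"
      then have "m \<otimes> (inv m \<otimes> f i) \<in> M" using M m subgroup.m_closed by metis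
      then show "f i \<in> M" using mc fc[OF i] by (simp flip: m_assoc)
    next
      assume "f i \<in> M"
      then show "inv m \<otimes> f i \<in> M" using M m subgroup.m_closed subgroup.m_inv_closed by metis
    qed
    then show "(regular_rep G f N m *\<^sub>v u) $ i = u $ i" using act[OF mc i] i by (simp add: u_def)
  qed (simp add: u_def regular_rep_def)
  obtain i where i: "i < N" "f i = \<one>" using f by (auto simp: bij_betw_def image_iff) (metis imageE lessThan_iff one_closed)
  have "inv y \<notin> M" using M y subgroup.m_inv_closed[OF M, of "inv y"] by auto
  then have "(regular_rep G f N y *\<^sub>v u) $ i = 0" using act[OF y(1) i(1)] i y by simp
  moreover have "u $ i = 1" using i subgroup.one_closed[OF M] by (simp add: u_def)
  ultimately show "regular_rep G f N y *\<^sub>v u \<noteq> u" by auto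
qed

text \<open>Among the unitary representations with an \<open>M\<close>-fixed vector that \<open>y\<close> moves, one of least degree is
  irreducible: otherwise project the vector to an invariant subspace and to its orthogonal complement.\<close>

lemma (in group) irreducible_moving_vector:
  assumes fin: "finite (carrier G)" and M: "subgroup M G" and y: "y \<in> carrier G" "y \<notin> M"
  obtains d \<rho> u where "irred_rep G d \<rho>" "unitary_rep G d \<rho>" "u \<in> carrier_vec d"
    "\<forall>m\<in>M. \<rho> m *\<^sub>v u = u" "\<rho> y *\<^sub>v u \<noteq> u"
proof -
  define Q where "Q d \<longleftrightarrow> (\<exists>\<rho> u. unitary_rep G d \<rho> \<and> u \<in> carrier_vec d \<and>
      (\<forall>m\<in>M. \<rho> m *\<^sub>v u = u) \<and> \<rho> y *\<^sub>v u \<noteq> u)" for d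
  have MG: "M \<subseteq> carrier G" using M subgroup.subset by blast
  obtain f where f: "bij_betw f {..<card (carrier G)} (carrier G)"
    using ex_bij_betw_nat_finite[OF fin] by (auto simp: atLeast0LessThan)
  have "Q (card (carrier G))"
    unfolding Q_def using unitary_rep_regular[OF f] regular_rep_separates[OF f M y] vec_carrier by blast
  then have QL: "Q (LEAST d. Q d)" by (rule LeastI)
  define d where "d = (LEAST d. Q d)"
  have Qd: "Q d" using QL unfolding d_def .
  have least: "\<not> Q e" if "e < d" for e using not_less_Least that unfolding d_def by blast
  obtain \<rho> u where \<rho>: "unitary_rep G d \<rho>" and u: "u \<in> carrier_vec d"
      and fix_u: "\<forall>m\<in>M. \<rho> m *\<^sub>v u = u" and moved: "\<rho> y *\<^sub>v u \<noteq> u"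
    using Qd unfolding Q_def by blast
  have rep: "is_rep G d \<rho>" using \<rho> unfolding unitary_rep_def by blast
  have \<rho>c: "\<rho> g \<in> carrier_mat d d" if "g \<in> carrier G" for g
    using rep that unfolding is_rep_def by blast
  \<comment> \<open>The displacement of \<open>u\<close> by \<open>y\<close>. A proper invariant
    subspace would force it to vanish.\<close>
  define v where "v = \<rho> y *\<^sub>v u + (-1) \<cdot>\<^sub>v u"
  have yu: "\<rho> y *\<^sub>v u \<in> carrier_vec d" using \<rho>c[OF y(1)] u by (metis mult_mat_vec_carrier)
  have v: "v \<in> carrier_vec d" unfolding v_def using yu u by auto
  have "v \<noteq> 0\<^sub>v d"
    using moved minus_eq_zero_vec[OF yu u] unfolding v_def by auto
  \<comment> \<open>In a subrepresentation of smaller degree the projection of \<open>u\<close> is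
    again fixed by \<open>M\<close>. By minimality \<open>y\<close> fixes it as well, so the
    projection annihilates \<open>v\<close>.\<close>
  have killed: "adj P *\<^sub>v v = 0\<^sub>v e"
    if P: "P \<in> carrier_mat d e" "unitary_rep G e \<sigma>" "\<forall>g\<in>carrier G. adj P * \<rho> g = \<sigma> g * adj P" "e < d"
    for P \<sigma> e
  proof (rule ccontr)
    assume nz: "adj P *\<^sub>v v \<noteq> 0\<^sub>v e"
    note aP = adj_carrier[OF P(1)]
    define a where "a = adj P *\<^sub>v u"
    have a: "a \<in> carrier_vec e" unfolding a_def using aP u by (metis mult_mat_vec_carrier)
    have \<sigma>c: "\<sigma> g \<in> carrier_mat e e" if "g \<in> carrier G" for g
      using P(2) that unfolding unitary_rep_def is_rep_def by blast
    have equiv: "\<sigma> g *\<^sub>v a = adj P *\<^sub>v (\<rho> g *\<^sub>v u)" if g: "g \<in> carrier G" for g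
      unfolding a_def using assoc_mult_mat_vec[OF \<sigma>c[OF g] aP u] assoc_mult_mat_vec[OF aP \<rho>c[OF g] u] P(3) g
      by simp
    have "\<forall>m\<in>M. \<sigma> m *\<^sub>v a = a" using equiv fix_u MG unfolding a_def by auto
    moreover have "\<sigma> y *\<^sub>v a \<noteq> a"
    proof
      assume eq: "\<sigma> y *\<^sub>v a = a"
      have "adj P *\<^sub>v v = adj P *\<^sub>v (\<rho> y *\<^sub>v u) + (-1) \<cdot>\<^sub>v a"
        unfolding v_def a_def using mult_add_distrib_mat_vec[OF aP yu, of "(-1) \<cdot>\<^sub>v u"] mult_mat_vec[OF aP u, of "-1"] u by simp
      also have "\<dots> = a + (-1) \<cdot>\<^sub>v a" using equiv[OF y(1)] eq by simp
      also have "\<dots> = 0\<^sub>v e" using a by (intro eq_vecI) auto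
      finally show False using nz by simp
    qed
    ultimately have "Q e" unfolding Q_def using P(2) a by blast
    then show False using least P(4) by blast
  qed
  have "irred_rep G d \<rho>"
    unfolding irred_rep_def
  proof (intro conjI allI impI)
    show "is_rep G d \<rho>" by (rule rep)
    show "0 < d"
    proof (rule ccontr)
      assume "\<not> 0 < d"
      then have "v = 0\<^sub>v d" using v by (intro eq_vecI) auto
      with \<open>v \<noteq> 0\<^sub>v d\<close> show False ..
    qed
    fix W assume W: "invariant_subspace G d \<rho> W"
    show "W = {0\<^sub>v d} \<or> W = carrier_vec d"
    proof (rule ccontr)
      assume proper: "\<not> ?thesis"
      have Wc: "W \<subseteq> carrier_vec d" "0\<^sub>v d \<in> W" using W unfolding invariant_subspace_def by blast+
      have small: "e < d" if P: "P \<in> carrier_mat d e" "adj P * P = 1\<^sub>m e" "\<forall>v\<in>carrier_vec e. P *\<^sub>v v \<in> U"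
          "U \<subset> carrier_vec d" for P e U
      proof (rule ccontr)
        assume "\<not> e < d"
        then have e: "e = d" using isometry_dim_le(1)[OF P(1,2)] by simp
        have "w \<in> U" if w: "w \<in> carrier_vec d" for w
        proof -
          have aw: "adj P *\<^sub>v w \<in> carrier_vec e" using adj_carrier[OF P(1)] w by (metis mult_mat_vec_carrier)
          have "P *\<^sub>v (adj P *\<^sub>v w) = w"
            using assoc_mult_mat_vec[OF P(1) adj_carrier[OF P(1)] w] isometry_dim_le(2)[OF P(1,2) e] w by simp
          then show ?thesis using bspec[OF P(3) aw] by simp
        qed
        with P(4) show False by blast
      qed
      obtain e P \<sigma> where P: "P \<in> carrier_mat d e" "adj P * P = 1\<^sub>m e" "\<forall>v\<in>carrier_vec e. P *\<^sub>v v \<in> W"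
          "\<forall>w\<in>W. P *\<^sub>v (adj P *\<^sub>v w) = w" "unitary_rep G e \<sigma>" "\<forall>g\<in>carrier G. adj P * \<rho> g = \<sigma> g * adj P"
        using restrict_unitary_rep[OF \<rho> W] by blast
      note aP = adj_carrier[OF P(1)]
      have vP: "adj P *\<^sub>v v = 0\<^sub>v e"
        by (rule killed[OF P(1,5,6) small[OF P(1,2,3)]]) (use Wc proper in blast)
      \<comment> \<open>The orthogonal complement of \<open>W\<close>, whose orthonormal basis is
        given by the columns of \<open>P\<close>. It contains \<open>v\<close> by \<open>vP\<close>,
        and projecting to it annihilates \<open>v\<close> once more.\<close>
      define W' where "W' = {w \<in> carrier_vec d. adj P *\<^sub>v w = 0\<^sub>v e}"
      have \<sigma>c: "\<sigma> g \<in> carrier_mat e e" if "g \<in> carrier G" for g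
        using P(5) that unfolding unitary_rep_def is_rep_def by blast
      have "invariant_subspace G d \<rho> W'"
        unfolding invariant_subspace_def
      proof (intro conjI ballI allI)
        show "W' \<subseteq> carrier_vec d" unfolding W'_def by blast
        show "0\<^sub>v d \<in> W'" using mult_mat_zero_vec[OF aP] unfolding W'_def by simp
        show "x + w \<in> W'" if "x \<in> W'" "w \<in> W'" for x w
          using that mult_add_distrib_mat_vec[OF aP, of x w] unfolding W'_def by auto
        show "c \<cdot>\<^sub>v w \<in> W'" if "w \<in> W'" for c w
          using that mult_mat_vec[OF aP, of w c] unfolding W'_def by auto
        show "\<rho> g *\<^sub>v w \<in> W'" if g: "g \<in> carrier G" and "w \<in> W'" for g w
        proof -
          have w: "w \<in> carrier_vec d" "adj P *\<^sub>v w = 0\<^sub>v e" using \<open>w \<in> W'\<close> unfolding W'_def by auto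
          have "adj P *\<^sub>v (\<rho> g *\<^sub>v w) = \<sigma> g *\<^sub>v (adj P *\<^sub>v w)"
            using assoc_mult_mat_vec[OF \<sigma>c[OF g] aP w(1)] assoc_mult_mat_vec[OF aP \<rho>c[OF g] w(1)] P(6) g
            by simp
          also have "\<dots> = 0\<^sub>v e" unfolding w(2) by (rule mult_mat_zero_vec[OF \<sigma>c[OF g]])
          finally show ?thesis unfolding W'_def using \<rho>c[OF g] w(1) by auto
        qed
      qed
      then obtain e' P' \<sigma>' where P': "P' \<in> carrier_mat d e'" "adj P' * P' = 1\<^sub>m e'" "\<forall>v\<in>carrier_vec e'. P' *\<^sub>v v \<in> W'"
          "\<forall>w\<in>W'. P' *\<^sub>v (adj P' *\<^sub>v w) = w" "unitary_rep G e' \<sigma>'" "\<forall>g\<in>carrier G. adj P' * \<rho> g = \<sigma>' g * adj P'"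
        using restrict_unitary_rep[OF \<rho>] by blast
      obtain w where w: "w \<in> W" "w \<noteq> 0\<^sub>v d" using proper Wc by blast
      have "w \<notin> W'"
      proof
        assume "w \<in> W'"
        then have "w = P *\<^sub>v 0\<^sub>v e" using P(4) w(1) unfolding W'_def by auto
        then show False using w(2) mult_mat_zero_vec[OF P(1)] by simp
      qed
      then have "W' \<subset> carrier_vec d" using w(1) Wc(1) unfolding W'_def by blast
      then have "adj P' *\<^sub>v v = 0\<^sub>v e'" by (rule killed[OF P'(1,5,6) small[OF P'(1,2,3)]])
      moreover have "v \<in> W'" using v vP unfolding W'_def by blast
      ultimately have "v = P' *\<^sub>v 0\<^sub>v e'" using P'(4) by force
      then show False using \<open>v \<noteq> 0\<^sub>v d\<close> mult_mat_zero_vec[OF P'(1)] by simp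
    qed
  qed
  with that \<rho> u fix_u moved show ?thesis by blast
qed

section \<open>Scalar matrices: Schur's lemma and extremal traces\<close>

lemma (in group) schur_scalar:
  assumes irr: "irred_rep G d \<rho>" and A: "A \<in> carrier_mat d d"
    and comm: "\<And>g. g \<in> carrier G \<Longrightarrow> A * \<rho> g = \<rho> g * A"
  shows "\<exists>c. A = c \<cdot>\<^sub>m 1\<^sub>m d"
proof -
  have d: "0 < d" and rep: "is_rep G d \<rho>" using irr unfolding irred_rep_def by blast+
  have \<rho>c: "\<rho> g \<in> carrier_mat d d" if "g \<in> carrier G" for g
    using rep that unfolding is_rep_def by blast
  obtain c v where v: "v \<in> carrier_vec d" "v \<noteq> 0\<^sub>v d" "A *\<^sub>v v = c \<cdot>\<^sub>v v"
    using spectrum_non_empty[OF A d] A unfolding spectrum_def eigenvalue_def eigenvector_def by auto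
  \<comment> \<open>The eigenspace of one existing eigenvalue is invariant because \<open>A\<close>
    commutes with the representation, so irreducibility makes it the whole space.\<close>
  define W where "W = {w \<in> carrier_vec d. A *\<^sub>v w = c \<cdot>\<^sub>v w}"
  have "invariant_subspace G d \<rho> W"
    unfolding invariant_subspace_def
  proof (intro conjI ballI allI)
    show "W \<subseteq> carrier_vec d" unfolding W_def by blast
    show "0\<^sub>v d \<in> W" using mult_mat_zero_vec[OF A] unfolding W_def by auto
    show "x + w \<in> W" if "x \<in> W" "w \<in> W" for x w
      using that mult_add_distrib_mat_vec[OF A, of x w] smult_add_distrib_vec[of x d w c] unfolding W_def by auto
    show "a \<cdot>\<^sub>v w \<in> W" if "w \<in> W" for a w
      using that mult_mat_vec[OF A, of w a] unfolding W_def by (auto simp: smult_smult_assoc mult.commute)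
    show "\<rho> g *\<^sub>v w \<in> W" if g: "g \<in> carrier G" and "w \<in> W" for g w
    proof -
      have w: "w \<in> carrier_vec d" "A *\<^sub>v w = c \<cdot>\<^sub>v w" using \<open>w \<in> W\<close> unfolding W_def by auto
      have "A *\<^sub>v (\<rho> g *\<^sub>v w) = \<rho> g *\<^sub>v (A *\<^sub>v w)"
        using assoc_mult_mat_vec[OF A \<rho>c[OF g] w(1)] assoc_mult_mat_vec[OF \<rho>c[OF g] A w(1)] comm[OF g] by simp
      also have "\<dots> = c \<cdot>\<^sub>v (\<rho> g *\<^sub>v w)" unfolding w(2) by (rule mult_mat_vec[OF \<rho>c[OF g] w(1)])
      finally show ?thesis unfolding W_def using \<rho>c[OF g] w(1) by auto
    qed
  qed
  then have "W = carrier_vec d" using irr v unfolding irred_rep_def W_def by blast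
  then have eig: "A *\<^sub>v w = c \<cdot>\<^sub>v w" if "w \<in> carrier_vec d" for w using that unfolding W_def by blast
  have "A = c \<cdot>\<^sub>m 1\<^sub>m d"
  proof (rule mat_eq_if_mult_vec_eq[OF A])
    fix w :: "complex vec" assume w: "w \<in> carrier_vec d"
    have "(c \<cdot>\<^sub>m 1\<^sub>m d) *\<^sub>v w = c \<cdot>\<^sub>v w"
      using w by (intro eq_vecI) (auto simp: smult_scalar_prod_distrib)
    then show "A *\<^sub>v w = (c \<cdot>\<^sub>m 1\<^sub>m d) *\<^sub>v w" using eig[OF w] by simp
  qed simp
  then show ?thesis by blast
qed

lemma unitary_scalar_trace:
  assumes "adj A * A = 1\<^sub>m d" "A = c \<cdot>\<^sub>m 1\<^sub>m d" "0 < d"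
  shows "cmod (mat_trace A) = real d"
proof -
  have A: "A \<in> carrier_mat d d" using assms(2) by simp
  have "(adj A * A) $$ (0, 0) = (\<Sum>k<d. cnj (A $$ (k, 0)) * A $$ (k, 0))"
    by (rule adj_mult_index[OF A assms(3) assms(3)])
  also have "\<dots> = (\<Sum>k<d. if k = 0 then cnj c * c else 0)"
    by (rule sum.cong) (use assms(2,3) in auto)
  also have "\<dots> = cnj c * c" using assms(3) by simp
  finally have "cnj c * c = 1" using assms(1,3) by simp
  then have "cmod c = 1"
    by (metis complex_mod_mult_cnj mult.commute norm_ge_zero norm_one power2_eq_1_iff power2_eq_square real_sqrt_abs real_sqrt_eq_1_iff abs_of_nonneg norm_of_real)
  then show ?thesis using assms(2) by (simp add: mat_trace_def norm_mult)
qed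

text \<open>The diagonal entries of a unitary matrix have modulus at most one; if the trace is extremal, they all
  equal the same unimodular number, which leaves no room for entries off the diagonal.\<close>

lemma unitary_extremal_trace:
  assumes A: "A \<in> carrier_mat d d" and uni: "adj A * A = 1\<^sub>m d" and tr: "cmod (mat_trace A) = real d" and d: "0 < d"
  shows "\<exists>c. A = c \<cdot>\<^sub>m 1\<^sub>m d"
proof -
  define c where "c = mat_trace A / of_nat d"
  have c: "cmod c = 1" unfolding c_def using tr d by (simp add: norm_divide)
  have col: "(\<Sum>k<d. (cmod (A $$ (k, j)))\<^sup>2) = 1" if j: "j < d" for j
  proof -
    have "complex_of_real (\<Sum>k<d. (cmod (A $$ (k, j)))\<^sup>2) = (\<Sum>k<d. cnj (A $$ (k, j)) * A $$ (k, j))"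
      unfolding of_real_sum by (rule sum.cong) (simp_all add: complex_norm_square mult.commute del: of_real_power)
    also have "\<dots> = 1" using adj_mult_index[OF A j j] uni j by simp
    finally show ?thesis by (metis of_real_eq_1_iff)
  qed
  have diag_le: "cmod (A $$ (j, j)) \<le> 1" if j: "j < d" for j
  proof -
    have "(cmod (A $$ (j, j)))\<^sup>2 \<le> 1"
      unfolding col[OF j, symmetric] by (rule member_le_sum[of j "{..<d}" "\<lambda>k. (cmod (A $$ (k, j)))\<^sup>2"]) (use j in auto)
    then show ?thesis by (simp add: abs_square_le_1)
  qed
  have re_le: "Re (cnj c * A $$ (j, j)) \<le> 1" if j: "j < d" for j
    using complex_Re_le_cmod[of "cnj c * A $$ (j, j)"] diag_le[OF j] c by (simp add: norm_mult)
  have "(\<Sum>j<d. Re (cnj c * A $$ (j, j))) = Re (cnj c * mat_trace A)"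
    using A unfolding mat_trace_def by (simp add: sum_distrib_left Re_sum)
  also have "cnj c * mat_trace A = of_nat d * (c * cnj c)" using d unfolding c_def by simp
  also have "c * cnj c = 1" using c by (simp add: complex_norm_square[symmetric] del: of_real_power)
  finally have "(\<Sum>j<d. 1 - Re (cnj c * A $$ (j, j))) = 0" by (simp add: sum_subtractf)
  then have re: "Re (cnj c * A $$ (j, j)) = 1" if j: "j < d" for j
    using sum_nonneg_eq_0_iff[of "{..<d}" "\<lambda>j. 1 - Re (cnj c * A $$ (j, j))"] re_le j by force
  have diag: "A $$ (j, j) = c" if j: "j < d" for j
  proof -
    let ?z = "cnj c * A $$ (j, j)"
    have "cmod ?z \<le> 1" using diag_le[OF j] c by (simp add: norm_mult)
    then have "(Re ?z)\<^sup>2 + (Im ?z)\<^sup>2 \<le> 1" unfolding cmod_def by simp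
    then have "?z = 1" using re[OF j] by (intro complex_eqI) auto
    then have "c * cnj c * A $$ (j, j) = c" by (simp add: mult.assoc)
    then show ?thesis using c by (simp add: complex_norm_square[symmetric] del: of_real_power)
  qed
  have off: "A $$ (k, j) = 0" if "k < d" "j < d" "k \<noteq> j" for k j
  proof -
    have "(\<Sum>k\<in>{..<d} - {j}. (cmod (A $$ (k, j)))\<^sup>2) = 0"
      using sum.remove[of "{..<d}" j "\<lambda>k. (cmod (A $$ (k, j)))\<^sup>2"] col[OF that(2)] diag[OF that(2)] c that(2) by simp
    then show ?thesis
      using sum_nonneg_eq_0_iff[of "{..<d} - {j}" "\<lambda>k. (cmod (A $$ (k, j)))\<^sup>2"] that by auto
  qed
  have "A = c \<cdot>\<^sub>m 1\<^sub>m d" by (rule eq_matI) (use A diag off in auto)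
  then show ?thesis by blast
qed

text \<open>\<open>K\<close> is the kernel of a representation affording \<open>\<chi>\<close>.\<close>

theorem (in group) separating_irr_char:
  assumes fin: "finite (carrier G)" and M: "M \<lhd> G" and y: "y \<in> carrier G" "y \<notin> M"
  obtains \<chi> K where "irr_char G \<chi>" "subgroup K G" "M \<subseteq> K" "y \<notin> K"
    "char_center G \<chi> = {x \<in> carrier G. \<forall>h\<in>carrier G. inv x \<otimes> inv h \<otimes> x \<otimes> h \<in> K}"
proof -
  have MS: "subgroup M G" using M normal_imp_subgroup by blast
  obtain d \<rho> u where irr: "irred_rep G d \<rho>" and uni: "unitary_rep G d \<rho>" and u: "u \<in> carrier_vec d"
    "\<forall>m\<in>M. \<rho> m *\<^sub>v u = u" "\<rho> y *\<^sub>v u \<noteq> u"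
    using irreducible_moving_vector[OF fin MS y] by blast
  have d: "0 < d" and rep: "is_rep G d \<rho>" using irr unfolding irred_rep_def by blast+
  have \<rho>c: "\<rho> g \<in> carrier_mat d d" if "g \<in> carrier G" for g
    using rep that unfolding is_rep_def by blast
  have mult: "\<rho> (g \<otimes> h) = \<rho> g * \<rho> h" if "g \<in> carrier G" "h \<in> carrier G" for g h
    using rep that unfolding is_rep_def by blast
  have one: "\<rho> \<one> = 1\<^sub>m d" using rep unfolding is_rep_def by blast
  have MG: "M \<subseteq> carrier G" using MS subgroup.subset by blast
  \<comment> \<open>Normality of \<open>M\<close> makes its fixed vectors an invariant subspace. It
    contains \<open>u\<close>, so it is everything and \<open>M\<close> acts trivially, not only on
    \<open>u\<close>.\<close>
  define F where "F = {v \<in> carrier_vec d. \<forall>m\<in>M. \<rho> m *\<^sub>v v = v}"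
  have "invariant_subspace G d \<rho> F"
    unfolding invariant_subspace_def
  proof (intro conjI ballI allI)
    show "F \<subseteq> carrier_vec d" unfolding F_def by blast
    show "0\<^sub>v d \<in> F" using mult_mat_zero_vec[OF \<rho>c] MG unfolding F_def by auto
    show "x + w \<in> F" if "x \<in> F" "w \<in> F" for x w
      using that mult_add_distrib_mat_vec[OF \<rho>c, of _ x w] MG unfolding F_def by auto
    show "c \<cdot>\<^sub>v w \<in> F" if "w \<in> F" for c w
      using that mult_mat_vec[OF \<rho>c, of _ w c] MG unfolding F_def by auto
    show "\<rho> g *\<^sub>v w \<in> F" if g: "g \<in> carrier G" and "w \<in> F" for g w
    proof -
      have w: "w \<in> carrier_vec d" "\<forall>m\<in>M. \<rho> m *\<^sub>v w = w" using \<open>w \<in> F\<close> unfolding F_def by auto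
      have "\<rho> m *\<^sub>v (\<rho> g *\<^sub>v w) = \<rho> g *\<^sub>v w" if m: "m \<in> M" for m
      proof -
        have mc: "m \<in> carrier G" using m MG by blast
        define m' where "m' = inv g \<otimes> m \<otimes> g"
        have m': "m' \<in> M" unfolding m'_def using normal.inv_op_closed1[OF M g m] .
        have m'c: "m' \<in> carrier G" using m' MG by blast
        have "m \<otimes> g = g \<otimes> m'" unfolding m'_def using mc g by (simp add: m_assoc[symmetric])
        then have "\<rho> m * \<rho> g = \<rho> g * \<rho> m'" using mult mc g m'c by metis
        then have "\<rho> m *\<^sub>v (\<rho> g *\<^sub>v w) = \<rho> g *\<^sub>v (\<rho> m' *\<^sub>v w)"
          using assoc_mult_mat_vec[OF \<rho>c[OF mc] \<rho>c[OF g] w(1)] assoc_mult_mat_vec[OF \<rho>c[OF g] \<rho>c[OF m'c] w(1)] by simp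
        then show ?thesis using w(2) m' by simp
      qed
      then show ?thesis unfolding F_def using \<rho>c[OF g] w(1) by auto
    qed
  qed
  moreover have "u \<in> F" unfolding F_def using u by blast
  moreover have "u \<noteq> 0\<^sub>v d"
  proof
    assume "u = 0\<^sub>v d"
    then show False using u(3) mult_mat_zero_vec[OF \<rho>c[OF y(1)]] by simp
  qed
  ultimately have F: "F = carrier_vec d" using irr unfolding irred_rep_def by blast
  define K where "K = {g \<in> carrier G. \<rho> g = 1\<^sub>m d}"
  have K: "subgroup K G"
  proof (rule subgroupI)
    show "K \<subseteq> carrier G" unfolding K_def by blast
    show "K \<noteq> {}" unfolding K_def using one by blast
    show "a \<otimes> b \<in> K" if "a \<in> K" "b \<in> K" for a b
      using that mult unfolding K_def by simp
    show "inv a \<in> K" if "a \<in> K" for a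
    proof -
      have a: "a \<in> carrier G" "\<rho> a = 1\<^sub>m d" using that unfolding K_def by auto
      have "\<rho> (inv a) = \<rho> a * \<rho> (inv a)" using a \<rho>c[OF inv_closed[OF a(1)]] by simp
      also have "\<dots> = 1\<^sub>m d" using mult[of a "inv a"] a one by simp
      finally show ?thesis unfolding K_def using a by simp
    qed
  qed
  have "M \<subseteq> K"
  proof
    fix m assume m: "m \<in> M"
    have "\<rho> m = 1\<^sub>m d"
    proof (rule mat_eq_if_mult_vec_eq[OF \<rho>c one_carrier_mat])
      show "\<rho> m *\<^sub>v v = 1\<^sub>m d *\<^sub>v v" if "v \<in> carrier_vec d" for v
        using that m F unfolding F_def by auto
    qed (use m MG in blast)
    then show "m \<in> K" unfolding K_def using m MG by blast
  qed
  moreover have "y \<notin> K" unfolding K_def using u by auto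
  moreover define \<chi> where "\<chi> g = mat_trace (\<rho> g)" for g
  moreover have "irr_char G \<chi>" unfolding irr_char_def \<chi>_def using irr by blast
  moreover have "char_center G \<chi> = {x \<in> carrier G. \<forall>h\<in>carrier G. inv x \<otimes> inv h \<otimes> x \<otimes> h \<in> K}"
  proof -
    have cancel: "a \<otimes> (inv a \<otimes> b) = b" if "a \<in> carrier G" "b \<in> carrier G" for a b
      using that by (simp flip: m_assoc)
    have commute_iff: "inv x \<otimes> inv h \<otimes> x \<otimes> h \<in> K \<longleftrightarrow> \<rho> x * \<rho> h = \<rho> h * \<rho> x"
      if xh: "x \<in> carrier G" "h \<in> carrier G" for x h
    proof
      assume "inv x \<otimes> inv h \<otimes> x \<otimes> h \<in> K"
      then have c1: "\<rho> (inv x \<otimes> inv h \<otimes> x \<otimes> h) = 1\<^sub>m d" unfolding K_def by blast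
      have "x \<otimes> h = (h \<otimes> x) \<otimes> (inv x \<otimes> inv h \<otimes> x \<otimes> h)"
        using xh by (simp add: m_assoc cancel)
      then have "\<rho> (x \<otimes> h) = \<rho> (h \<otimes> x) * 1\<^sub>m d"
        using mult[of "h \<otimes> x" "inv x \<otimes> inv h \<otimes> x \<otimes> h"] c1 xh by simp
      also have "\<rho> (h \<otimes> x) * 1\<^sub>m d = \<rho> (h \<otimes> x)"
        by (rule right_mult_one_mat[OF \<rho>c]) (use xh in simp)
      finally show "\<rho> x * \<rho> h = \<rho> h * \<rho> x" unfolding mult[OF xh] mult[OF xh(2,1)] .
    next
      assume eq: "\<rho> x * \<rho> h = \<rho> h * \<rho> x"
      have "inv x \<otimes> inv h \<otimes> x \<otimes> h = inv (h \<otimes> x) \<otimes> (x \<otimes> h)"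
        using xh by (simp add: m_assoc inv_mult_group)
      then have "\<rho> (inv x \<otimes> inv h \<otimes> x \<otimes> h) = \<rho> (inv (h \<otimes> x)) * \<rho> (x \<otimes> h)"
        using mult[of "inv (h \<otimes> x)" "x \<otimes> h"] xh by simp
      also have "\<dots> = \<rho> (inv (h \<otimes> x)) * \<rho> (h \<otimes> x)" using eq mult xh by simp
      also have "\<dots> = 1\<^sub>m d" using mult[of "inv (h \<otimes> x)" "h \<otimes> x", symmetric] xh one by simp
      finally show "inv x \<otimes> inv h \<otimes> x \<otimes> h \<in> K" unfolding K_def using xh by simp
    qed
    have \<chi>1: "\<chi> \<one> = of_nat d" unfolding \<chi>_def one mat_trace_def by simp
    \<comment> \<open>For a unitary matrix an extremal trace means a scalar matrix, and by Schur's
      lemma the scalar images are those commuting with all others. So the center of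
      \<open>\<chi>\<close> is the preimage of the center of G/K.\<close>
    have "complex_of_real (cmod (\<chi> x)) = \<chi> \<one> \<longleftrightarrow> (\<forall>h\<in>carrier G. \<rho> x * \<rho> h = \<rho> h * \<rho> x)"
      if x: "x \<in> carrier G" for x
    proof -
      have adj: "adj (\<rho> x) * \<rho> x = 1\<^sub>m d" using uni x unfolding unitary_rep_def by blast
      have "complex_of_real (cmod (\<chi> x)) = \<chi> \<one> \<longleftrightarrow> cmod (mat_trace (\<rho> x)) = real d"
        unfolding \<chi>1 unfolding \<chi>_def using of_real_eq_iff[of "cmod (mat_trace (\<rho> x))" "real d", where 'a = complex] by simp
      also have "\<dots> \<longleftrightarrow> (\<exists>c. \<rho> x = c \<cdot>\<^sub>m 1\<^sub>m d)"
        using unitary_extremal_trace[OF \<rho>c[OF x] adj _ d] unitary_scalar_trace[OF adj _ d] by blast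
      also have "\<dots> \<longleftrightarrow> (\<forall>h\<in>carrier G. \<rho> x * \<rho> h = \<rho> h * \<rho> x)"
      proof
        assume "\<exists>c. \<rho> x = c \<cdot>\<^sub>m 1\<^sub>m d"
        then obtain c where c: "\<rho> x = c \<cdot>\<^sub>m 1\<^sub>m d" ..
        show "\<forall>h\<in>carrier G. \<rho> x * \<rho> h = \<rho> h * \<rho> x"
        proof
          fix h assume h: "h \<in> carrier G"
          show "\<rho> x * \<rho> h = \<rho> h * \<rho> x"
            unfolding c mult_smult_assoc_mat[OF one_carrier_mat \<rho>c[OF h]]
              mult_smult_distrib[OF \<rho>c[OF h] one_carrier_mat]
              left_mult_one_mat[OF \<rho>c[OF h]] right_mult_one_mat[OF \<rho>c[OF h]] ..
        qed
      next
        assume "\<forall>h\<in>carrier G. \<rho> x * \<rho> h = \<rho> h * \<rho> x"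
        then show "\<exists>c. \<rho> x = c \<cdot>\<^sub>m 1\<^sub>m d" using schur_scalar[OF irr \<rho>c[OF x]] by blast
      qed
      finally show ?thesis .
    qed
    then show ?thesis unfolding char_center_def using commute_iff by auto
  qed
  ultimately show ?thesis using that K by blast
qed

section \<open>The chain of centers\<close>

definition comm :: "('a, 'b) monoid_scheme \<Rightarrow> 'a \<Rightarrow> 'a \<Rightarrow> 'a" where
  "comm G x h = inv\<^bsub>G\<^esub> x \<otimes>\<^bsub>G\<^esub> inv\<^bsub>G\<^esub> h \<otimes>\<^bsub>G\<^esub> x \<otimes>\<^bsub>G\<^esub> h"

definition center :: "('a, 'b) monoid_scheme \<Rightarrow> 'a set" where
  "center G = {z \<in> carrier G. \<forall>h\<in>carrier G. z \<otimes>\<^bsub>G\<^esub> h = h \<otimes>\<^bsub>G\<^esub> z}"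

section \<open>Commutators and the pairing in class two\<close>

context group
begin

lemma comm_closed [simp]: "x \<in> carrier G \<Longrightarrow> h \<in> carrier G \<Longrightarrow> comm G x h \<in> carrier G"
  unfolding comm_def by simp

lemma mult_inv_cancel: "a \<in> carrier G \<Longrightarrow> b \<in> carrier G \<Longrightarrow> a \<otimes> (inv a \<otimes> b) = b"
  by (simp flip: m_assoc)

lemma mult_comm:
  "x \<in> carrier G \<Longrightarrow> h \<in> carrier G \<Longrightarrow> h \<otimes> x \<otimes> comm G x h = x \<otimes> h"
  unfolding comm_def by (simp add: m_assoc mult_inv_cancel)

lemma comm_unique:
  assumes "x \<in> carrier G" "h \<in> carrier G" "c \<in> carrier G" "x \<otimes> h = h \<otimes> x \<otimes> c"
  shows "comm G x h = c"
proof -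
  have "h \<otimes> x \<otimes> comm G x h = h \<otimes> x \<otimes> c" using mult_comm assms by simp
  then show ?thesis using assms by simp
qed

lemma comm_one [simp]: "x \<in> carrier G \<Longrightarrow> comm G x \<one> = \<one>"
  by (rule comm_unique) auto

lemma comm_self [simp]: "x \<in> carrier G \<Longrightarrow> comm G x x = \<one>"
  by (rule comm_unique) auto

lemma inv_comm_eq: "x \<in> carrier G \<Longrightarrow> h \<in> carrier G \<Longrightarrow> inv (comm G x h) = comm G h x"
  unfolding comm_def by (simp add: inv_mult_group m_assoc)

lemma center_commute: "z \<in> center G \<Longrightarrow> h \<in> carrier G \<Longrightarrow> z \<otimes> h = h \<otimes> z"
  unfolding center_def by blast

lemma center_closed: "z \<in> center G \<Longrightarrow> z \<in> carrier G"
  unfolding center_def by blast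

lemma subgroup_center: "subgroup (center G) G"
proof (rule subgroupI)
  show "center G \<subseteq> carrier G" "center G \<noteq> {}" unfolding center_def by auto
  show "inv a \<in> center G" if "a \<in> center G" for a
  proof -
    have a: "a \<in> carrier G" using that center_closed by blast
    have "inv a \<otimes> h = h \<otimes> inv a" if h: "h \<in> carrier G" for h
    proof -
      have "inv a \<otimes> h = inv a \<otimes> (h \<otimes> a) \<otimes> inv a" using a h by (simp add: m_assoc)
      also have "h \<otimes> a = a \<otimes> h" using center_commute[OF \<open>a \<in> center G\<close> h] by simp
      also have "inv a \<otimes> (a \<otimes> h) \<otimes> inv a = h \<otimes> inv a" using a h by (simp flip: m_assoc)
      finally show ?thesis .
    qed
    then show ?thesis unfolding center_def using a by blast
  qed
  show "a \<otimes> b \<in> center G" if "a \<in> center G" "b \<in> center G" for a b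
  proof -
    have ab: "a \<in> carrier G" "b \<in> carrier G" using that center_closed by blast+
    have "a \<otimes> b \<otimes> h = h \<otimes> (a \<otimes> b)" if h: "h \<in> carrier G" for h
    proof -
      have "a \<otimes> b \<otimes> h = a \<otimes> (h \<otimes> b)" using center_commute[OF \<open>b \<in> center G\<close> h] ab h by (simp add: m_assoc)
      also have "\<dots> = h \<otimes> a \<otimes> b" using center_commute[OF \<open>a \<in> center G\<close> h] ab h by (simp flip: m_assoc)
      finally show ?thesis using ab h by (simp add: m_assoc)
    qed
    then show ?thesis unfolding center_def using ab by simp
  qed
qed

lemma center_subgroup_normal:
  assumes "subgroup K G" "K \<subseteq> center G"
  shows "K \<lhd> G"
  unfolding normal_inv_iff
proof (intro conjI ballI assms(1))
  fix x h assume x: "x \<in> carrier G" and h: "h \<in> K"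
  have hc: "h \<in> carrier G" "x \<otimes> h = h \<otimes> x" using h assms(2) center_closed center_commute[of h x] x by auto
  then have "x \<otimes> h \<otimes> inv x = h" using x by (simp add: m_assoc)
  then show "x \<otimes> h \<otimes> inv x \<in> K" using h by simp
qed

text \<open>The usual expansion conjugates \<open>comm G x h\<close> by \<open>y\<close>; centrality
  removes the conjugation.\<close>

lemma comm_mult_left:
  assumes xyh: "x \<in> carrier G" "y \<in> carrier G" "h \<in> carrier G" and c: "comm G x h \<in> center G"
  shows "comm G (x \<otimes> y) h = comm G x h \<otimes> comm G y h"
proof (rule comm_unique)
  let ?c = "comm G x h" and ?d = "comm G y h"
  have cd: "?c \<in> carrier G" "?d \<in> carrier G" using xyh by simp_all
  have "x \<otimes> y \<otimes> h = x \<otimes> (h \<otimes> y \<otimes> ?d)" using mult_comm[OF xyh(2,3)] xyh by (simp add: m_assoc)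
  also have "\<dots> = x \<otimes> h \<otimes> (y \<otimes> ?d)" using xyh cd by (simp add: m_assoc)
  also have "\<dots> = h \<otimes> x \<otimes> ?c \<otimes> (y \<otimes> ?d)" using mult_comm[OF xyh(1,3)] by simp
  also have "\<dots> = h \<otimes> x \<otimes> ((?c \<otimes> y) \<otimes> ?d)" using xyh cd by (simp add: m_assoc)
  also have "\<dots> = h \<otimes> x \<otimes> ((y \<otimes> ?c) \<otimes> ?d)" using center_commute[OF c xyh(2)] by simp
  also have "\<dots> = h \<otimes> (x \<otimes> y) \<otimes> (?c \<otimes> ?d)" using xyh cd by (simp add: m_assoc)
  finally show "x \<otimes> y \<otimes> h = h \<otimes> (x \<otimes> y) \<otimes> (?c \<otimes> ?d)" .
qed (use xyh in auto)

lemma comm_mult_right: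
  assumes xhk: "x \<in> carrier G" "h \<in> carrier G" "k \<in> carrier G" and c: "comm G x h \<in> center G"
  shows "comm G x (h \<otimes> k) = comm G x h \<otimes> comm G x k"
proof (rule comm_unique)
  let ?c = "comm G x h" and ?d = "comm G x k"
  have cd: "?c \<in> carrier G" "?d \<in> carrier G" using xhk by simp_all
  have "x \<otimes> (h \<otimes> k) = h \<otimes> x \<otimes> ?c \<otimes> k" using mult_comm[OF xhk(1,2)] xhk by (simp add: m_assoc)
  also have "\<dots> = h \<otimes> x \<otimes> (k \<otimes> ?c)" using center_commute[OF c xhk(3)] xhk cd by (simp add: m_assoc)
  also have "\<dots> = h \<otimes> (x \<otimes> k) \<otimes> ?c" using xhk cd by (simp add: m_assoc)
  also have "\<dots> = h \<otimes> (k \<otimes> x \<otimes> ?d) \<otimes> ?c" using mult_comm[OF xhk(1,3)] by simp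
  also have "\<dots> = h \<otimes> k \<otimes> x \<otimes> (?d \<otimes> ?c)" using xhk cd by (simp add: m_assoc)
  also have "?d \<otimes> ?c = ?c \<otimes> ?d" using center_commute[OF c cd(2)] by simp
  finally show "x \<otimes> (h \<otimes> k) = h \<otimes> k \<otimes> x \<otimes> (?c \<otimes> ?d)" .
qed (use xhk in auto)

lemma comm_subgroup_eq: "comm_subgroup G H K = generate G {comm G h k | h k. h \<in> H \<and> k \<in> K}"
  unfolding comm_subgroup_def comm_def by (rule arg_cong[of _ _ "generate G"]) blast

lemma comm_in_comm_subgroup: "h \<in> H \<Longrightarrow> k \<in> K \<Longrightarrow> comm G h k \<in> comm_subgroup G H K"
  unfolding comm_subgroup_eq by (rule generate.incl) blast

lemma subgroup_comm_subgroup: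
  "H \<subseteq> carrier G \<Longrightarrow> K \<subseteq> carrier G \<Longrightarrow> subgroup (comm_subgroup G H K) G"
  unfolding comm_subgroup_eq by (rule generate_is_subgroup) (blast intro: comm_closed)

lemma comm_subgroup_subset:
  assumes "subgroup S G" "\<And>h k. h \<in> H \<Longrightarrow> k \<in> K \<Longrightarrow> comm G h k \<in> S"
  shows "comm_subgroup G H K \<subseteq> S"
  unfolding comm_subgroup_eq by (rule generate_subgroup_incl[OF _ assms(1)]) (use assms(2) in blast)

text \<open>\<open>derived\<close> is generated by the commutators with the inverses on the right;
  inverting both entries passes from one convention to the other.\<close>

lemma derived_eq_comm_subgroup: "derived G (carrier G) = comm_subgroup G (carrier G) (carrier G)"
proof -
  have "derived_set G (carrier G) = {comm G h k | h k. h \<in> carrier G \<and> k \<in> carrier G}"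
  proof (intro equalityI subsetI)
    fix z assume "z \<in> derived_set G (carrier G)"
    then obtain h k where hk: "h \<in> carrier G" "k \<in> carrier G" "z = h \<otimes> k \<otimes> inv h \<otimes> inv k" by blast
    then have "z = comm G (inv h) (inv k)" unfolding comm_def by simp
    then show "z \<in> {comm G h k | h k. h \<in> carrier G \<and> k \<in> carrier G}" using hk by blast
  next
    fix z assume "z \<in> {comm G h k | h k. h \<in> carrier G \<and> k \<in> carrier G}"
    then obtain h k where hk: "h \<in> carrier G" "k \<in> carrier G" "z = comm G h k" by blast
    then have "z \<in> {inv h \<otimes> inv k \<otimes> inv (inv h) \<otimes> inv (inv k)}" unfolding comm_def by simp
    then show "z \<in> derived_set G (carrier G)"
      by (rule UN_I[OF inv_closed[OF hk(1)] UN_I[OF inv_closed[OF hk(2)]]])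
  qed
  then show ?thesis unfolding derived_def comm_subgroup_eq by simp
qed

lemma comm_group_center: "comm_group (G\<lparr>carrier := center G\<rparr>)"
proof -
  interpret Z: group "G\<lparr>carrier := center G\<rparr>" by (rule subgroup_imp_group[OF subgroup_center])
  show ?thesis
    by (rule Z.group_comm_groupI) (use center_commute center_closed in auto)
qed

lemma card_coset_image:
  assumes "finite (carrier G)" "subgroup K G" "subgroup N G" "K \<subseteq> N"
  shows "card ((\<lambda>a. K #> a) ` N) * card K = card N"
proof -
  interpret N: group "G\<lparr>carrier := N\<rparr>" by (rule subgroup_imp_group[OF assms(3)])
  have "subgroup K (G\<lparr>carrier := N\<rparr>)" using subgroup_incl[OF assms(2,3,4)] .
  moreover have "rcosets\<^bsub>G\<lparr>carrier := N\<rparr>\<^esub> K = (\<lambda>a. K #> a) ` N"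
    by (auto simp: RCOSETS_def r_coset_def)
  ultimately show ?thesis using N.lagrange[of K] by (simp add: Coset.order_def)
qed

text \<open>The commutator map descends to an alternating pairing of \<open>G/X\<close> with itself into \<open>Z(G)/K\<close>.\<close>

theorem commutator_pairing_bound:
  fixes p :: nat
  assumes fin: "finite (carrier G)" and p: "Factorial_Ring.prime p" and card_G: "card (carrier G) = p ^ m"
    and central: "\<And>x h. \<lbrakk>x \<in> carrier G; h \<in> carrier G\<rbrakk> \<Longrightarrow> comm G x h \<in> center G"
    and K: "subgroup K G" "K \<subseteq> center G" and N: "subgroup N G" "K \<subseteq> N" "N \<subseteq> center G"
    and X: "X = {g \<in> carrier G. \<forall>h\<in>carrier G. comm G g h \<in> K}" "X \<noteq> carrier G"
    and onto: "\<And>g a. \<lbrakk>g \<in> carrier G; g \<notin> X; a \<in> N\<rbrakk> \<Longrightarrow> \<exists>h\<in>carrier G. \<exists>k\<in>K. a = comm G g h \<otimes> k"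
  shows "(card N)\<^sup>2 * card X \<le> (card K)\<^sup>2 * card (carrier G)"
proof -
  have KN: "K \<lhd> G" by (rule center_subgroup_normal[OF K])
  \<comment> \<open>A commutator is central, so its own commutators are trivial. This makes
    \<open>X\<close> normal and G/X abelian.\<close>
  have comm_in_X: "comm G x h \<in> X" if "x \<in> carrier G" "h \<in> carrier G" for x h
  proof -
    have "comm G (comm G x h) k = \<one>" if "k \<in> carrier G" for k
      by (rule comm_unique) (use that central[OF \<open>x \<in> carrier G\<close> \<open>h \<in> carrier G\<close>] center_commute \<open>x \<in> carrier G\<close> \<open>h \<in> carrier G\<close> in auto)
    then show ?thesis unfolding X(1) using that subgroup.one_closed[OF K(1)] by simp
  qed
  have XS: "subgroup X G"
  proof (rule subgroupI)
    show "X \<subseteq> carrier G" unfolding X(1) by blast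
    show "X \<noteq> {}" using comm_in_X by blast
    show "a \<otimes> b \<in> X" if "a \<in> X" "b \<in> X" for a b
      using that comm_mult_left central subgroup.m_closed[OF K(1)] unfolding X(1) by simp
    show "inv a \<in> X" if "a \<in> X" for a
    proof -
      have a: "a \<in> carrier G" "\<And>h. h \<in> carrier G \<Longrightarrow> comm G a h \<in> K" using that unfolding X(1) by auto
      have "comm G (inv a) h \<in> K" if h: "h \<in> carrier G" for h
      proof -
        have "comm G (a \<otimes> inv a) h = comm G a h \<otimes> comm G (inv a) h"
          by (rule comm_mult_left) (use a h central in auto)
        moreover have "comm G \<one> h = \<one>" by (rule comm_unique) (use h in auto)
        ultimately have "comm G (inv a) h = inv (comm G a h)"
          using a h by (metis comm_closed inv_closed inv_equality inv_inv r_inv)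
        then show ?thesis using a h subgroup.m_inv_closed[OF K(1)] by simp
      qed
      then show ?thesis unfolding X(1) using a by simp
    qed
  qed
  have XG: "X \<subseteq> carrier G" using XS subgroup.subset by blast
  have XN: "X \<lhd> G"
    unfolding normal_inv_iff
  proof (intro conjI ballI XS)
    fix x h assume x: "x \<in> carrier G" and h: "h \<in> X"
    have hc: "h \<in> carrier G" using h XG by blast
    have "x \<otimes> h \<otimes> inv x = h \<otimes> comm G h (inv x)"
      using x hc by (simp add: comm_def m_assoc mult_inv_cancel)
    then show "x \<otimes> h \<otimes> inv x \<in> X" using h comm_in_X[OF hc] x subgroup.m_closed[OF XS] by simp
  qed
  define Q where "Q = G Mod X"
  \<comment> \<open>All values of the pairing come from the center, so the target is a quotient of
    the center, which is abelian by construction.\<close>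
  define A where "A = (G\<lparr>carrier := center G\<rparr>) Mod K"
  interpret Z: comm_group "G\<lparr>carrier := center G\<rparr>" by (rule comm_group_center)
  have KZ: "subgroup K (G\<lparr>carrier := center G\<rparr>)" by (rule subgroup_incl[OF K(1) subgroup_center K(2)])
  have A: "comm_group A" unfolding A_def by (rule Z.abelian_FactGroup[OF KZ])
  have carrier_A: "carrier A = (\<lambda>a. K #> a) ` center G"
    unfolding A_def carrier_FactGroup by (simp add: r_coset_def)
  have mult_A: "(K #> a) \<otimes>\<^bsub>A\<^esub> (K #> b) = K #> (a \<otimes> b)" if "a \<in> carrier G" "b \<in> carrier G" for a b
    using normal.rcos_sum[OF KN that] unfolding A_def by (simp add: set_mult_def)
  have one_A: "\<one>\<^bsub>A\<^esub> = K" unfolding A_def by simp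
  have carrier_Q: "carrier Q = (\<lambda>g. X #> g) ` carrier G" unfolding Q_def carrier_FactGroup ..
  have mult_Q: "(X #> g) \<otimes>\<^bsub>Q\<^esub> (X #> h) = X #> (g \<otimes> h)" if "g \<in> carrier G" "h \<in> carrier G" for g h
    using normal.rcos_sum[OF XN that] unfolding Q_def by simp
  have one_Q: "\<one>\<^bsub>Q\<^esub> = X" unfolding Q_def by simp
  interpret QG: group Q unfolding Q_def by (rule normal.factorgroup_is_group[OF XN])
  have Q: "comm_group Q"
  proof (rule QG.group_comm_groupI)
    fix U V assume "U \<in> carrier Q" "V \<in> carrier Q"
    then obtain g h where gh: "g \<in> carrier G" "h \<in> carrier G" "U = X #> g" "V = X #> h"
      unfolding carrier_Q by blast
    have "g \<otimes> h = h \<otimes> g \<otimes> comm G g h" using mult_comm gh by simp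
    also have "\<dots> = comm G g h \<otimes> (h \<otimes> g)" using center_commute[OF central] gh by simp
    finally have "X #> (g \<otimes> h) = X #> comm G g h #> (h \<otimes> g)"
      using coset_mult_assoc[OF XG] gh by simp
    also have "X #> comm G g h = X" using coset_join2[OF _ XS comm_in_X] gh by simp
    finally show "U \<otimes>\<^bsub>Q\<^esub> V = V \<otimes>\<^bsub>Q\<^esub> U" using mult_Q gh by simp
  qed
  \<comment> \<open>The pairing is defined through chosen representatives. Changing either one by an
    element of \<open>X\<close> multiplies the commutator by an element of \<open>K\<close>, so the
    choice does not show in \<open>\<beta>\<close>.\<close>
  define rep where "rep U = (SOME g. g \<in> carrier G \<and> U = X #> g)" for U
  define \<beta> where "\<beta> U V = K #> comm G (rep U) (rep V)" for U V
  have \<beta>: "\<beta> (X #> g) (X #> h) = K #> comm G g h" if gh: "g \<in> carrier G" "h \<in> carrier G" for g h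
  proof -
    have rep: "rep (X #> g) \<in> carrier G \<and> (\<exists>x\<in>X. rep (X #> g) = x \<otimes> g)" if g: "g \<in> carrier G" for g
    proof -
      have "rep (X #> g) \<in> carrier G \<and> X #> g = X #> rep (X #> g)"
        unfolding rep_def by (rule someI_ex) (use g in blast)
      then have "rep (X #> g) \<in> carrier G \<and> rep (X #> g) \<in> X #> g" using rcos_self[OF _ XS] by metis
      then show ?thesis by (auto simp: r_coset_def)
    qed
    obtain x where x: "x \<in> X" "rep (X #> g) = x \<otimes> g" using rep[OF gh(1)] by blast
    obtain y where y: "y \<in> X" "rep (X #> h) = y \<otimes> h" using rep[OF gh(2)] by blast
    have xy: "x \<in> carrier G" "y \<in> carrier G" using x y XG by auto
    have yh: "y \<otimes> h \<in> carrier G" using xy gh by simp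
    have swap: "comm G g y \<in> K"
    proof -
      have "comm G g y = inv (comm G y g)" using inv_comm_eq xy gh by simp
      moreover have "comm G y g \<in> K" using y gh unfolding X(1) by blast
      ultimately show ?thesis using subgroup.m_inv_closed[OF K(1)] by simp
    qed
    have "comm G (x \<otimes> g) (y \<otimes> h) = comm G x (y \<otimes> h) \<otimes> (comm G g y \<otimes> comm G g h)"
      using comm_mult_left[OF xy(1) gh(1) yh] comm_mult_right[OF gh(1) xy(2) gh(2)] central xy gh yh by simp
    also have "\<dots> = (comm G x (y \<otimes> h) \<otimes> comm G g y) \<otimes> comm G g h" using xy gh by (simp add: m_assoc)
    finally have eq: "comm G (x \<otimes> g) (y \<otimes> h) = (comm G x (y \<otimes> h) \<otimes> comm G g y) \<otimes> comm G g h" .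
    have kK: "comm G x (y \<otimes> h) \<otimes> comm G g y \<in> K"
      using swap x(1) yh subgroup.m_closed[OF K(1)] unfolding X(1) by simp
    have KG: "K \<subseteq> carrier G" using K(1) subgroup.subset by blast
    have "K #> comm G (x \<otimes> g) (y \<otimes> h) = K #> (comm G x (y \<otimes> h) \<otimes> comm G g y) #> comm G g h"
      unfolding eq using coset_mult_assoc[OF KG, of "comm G x (y \<otimes> h) \<otimes> comm G g y" "comm G g h"] xy gh by simp
    also have "K #> (comm G x (y \<otimes> h) \<otimes> comm G g y) = K"
      using coset_join2[OF _ K(1) kK] kK KG by blast
    finally show ?thesis unfolding \<beta>_def x(2) y(2) .
  qed
  define N' where "N' = (\<lambda>a. K #> a) ` N"
  have NG: "N \<subseteq> carrier G" using N(1) subgroup.subset by blast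
  have "card N' ^ 2 \<le> card (carrier Q)"
  proof (rule alternating_pairing_bound[OF p Q])
    show "finite (carrier Q)" unfolding carrier_Q using fin by simp
    have cQ: "card (carrier Q) * card X = p ^ m"
      using lagrange[OF XS] card_G unfolding Q_def FactGroup_def Coset.order_def by simp
    then obtain l where "card (carrier Q) = p ^ l"
      using divides_primepow_nat[OF p] by (metis dvd_triv_left)
    \<comment> \<open>The bound applied here has the exponent as a parameter fixed for all its
      premises, so the exponent is named by a term that does not mention the local
      \<open>l\<close>.\<close>
    then show "card (carrier Q) = p ^ (SOME l. card (carrier Q) = p ^ l)" by (rule someI)
    show "carrier Q \<noteq> {\<one>\<^bsub>Q\<^esub>}"
    proof
      assume triv: "carrier Q = {\<one>\<^bsub>Q\<^esub>}"
      have "g \<in> X" if g: "g \<in> carrier G" for g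
      proof -
        have "X #> g = X" using triv g unfolding carrier_Q one_Q by blast
        then show ?thesis using coset_join1[OF _ g XS] by blast
      qed
      with X(2) XG show False by blast
    qed
    show "comm_group A" by (rule A)
    show "finite (carrier A)" unfolding carrier_A using fin by (simp add: center_def)
    fix U assume "U \<in> carrier Q"
    then obtain g where g: "g \<in> carrier G" "U = X #> g" unfolding carrier_Q by blast
    show "\<beta> U \<in> hom Q A"
    proof (rule homI)
      fix V assume "V \<in> carrier Q"
      then obtain h where h: "h \<in> carrier G" "V = X #> h" unfolding carrier_Q by blast
      show "\<beta> U V \<in> carrier A" unfolding g h carrier_A \<beta>[OF g(1) h(1)] using central[OF g(1) h(1)] by blast
      fix V' assume "V' \<in> carrier Q"
      then obtain h' where h': "h' \<in> carrier G" "V' = X #> h'" unfolding carrier_Q by blast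
      show "\<beta> U (V \<otimes>\<^bsub>Q\<^esub> V') = \<beta> U V \<otimes>\<^bsub>A\<^esub> \<beta> U V'"
        using g h h' \<beta> mult_Q mult_A comm_mult_right[OF g(1) h(1) h'(1)] central by simp
    qed
    show "(\<lambda>V. \<beta> V U) \<in> hom Q A"
    proof (rule homI)
      fix V assume "V \<in> carrier Q"
      then obtain h where h: "h \<in> carrier G" "V = X #> h" unfolding carrier_Q by blast
      show "\<beta> V U \<in> carrier A" unfolding g h carrier_A \<beta>[OF h(1) g(1)] using central[OF h(1) g(1)] by blast
      fix V' assume "V' \<in> carrier Q"
      then obtain h' where h': "h' \<in> carrier G" "V' = X #> h'" unfolding carrier_Q by blast
      show "\<beta> (V \<otimes>\<^bsub>Q\<^esub> V') U = \<beta> V U \<otimes>\<^bsub>A\<^esub> \<beta> V' U"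
        using g h h' \<beta> mult_Q mult_A comm_mult_left[OF h(1) h'(1) g(1)] central by simp
    qed
    show "\<beta> U U = \<one>\<^bsub>A\<^esub>"
      unfolding g \<beta>[OF g(1) g(1)] one_A comm_self[OF g(1)] using coset_join2[OF _ K(1)] subgroup.one_closed[OF K(1)] by simp
    fix a' assume "U \<noteq> \<one>\<^bsub>Q\<^esub>" "a' \<in> N'"
    then obtain a where a: "a \<in> N" "a' = K #> a" unfolding N'_def by blast
    have "g \<notin> X" using \<open>U \<noteq> \<one>\<^bsub>Q\<^esub>\<close> coset_join2[OF g(1) XS] unfolding g one_Q by blast
    then obtain h k where hk: "h \<in> carrier G" "k \<in> K" "a = comm G g h \<otimes> k" using onto[OF g(1) _ a(1)] by blast
    have kc: "k \<in> carrier G" using hk(2) K(2) center_closed by blast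
    have "a = k \<otimes> comm G g h" using hk center_commute[of k "comm G g h"] K(2) g(1) by auto
    then have "a' = K #> k #> comm G g h"
      unfolding a using coset_mult_assoc[OF _ kc, of K "comm G g h"] subgroup.subset[OF K(1)] g(1) hk(1) by simp
    then have "\<beta> U (X #> h) = a'" unfolding g \<beta>[OF g(1) hk(1)] coset_join2[OF kc K(1) hk(2)] by simp
    then show "\<exists>V\<in>carrier Q. \<beta> U V = a'" unfolding carrier_Q using hk(1) by blast
  next
    interpret Am: comm_group A by (rule A)
    show "subgroup N' A"
    proof (rule Am.subgroupI)
      show "N' \<subseteq> carrier A" unfolding N'_def carrier_A using N(3) by blast
      show "N' \<noteq> {}" unfolding N'_def using subgroup.one_closed[OF N(1)] by blast
      show "a \<otimes>\<^bsub>A\<^esub> b \<in> N'" if "a \<in> N'" "b \<in> N'" for a b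
      proof -
        obtain a' b' where "a' \<in> N" "b' \<in> N" "a = K #> a'" "b = K #> b'"
          using \<open>a \<in> N'\<close> \<open>b \<in> N'\<close> unfolding N'_def by blast
        moreover from this have "a \<otimes>\<^bsub>A\<^esub> b = K #> (a' \<otimes> b')" using mult_A NG by blast
        ultimately show ?thesis unfolding N'_def using subgroup.m_closed[OF N(1)] by blast
      qed
      show "inv\<^bsub>A\<^esub> a \<in> N'" if "a \<in> N'" for a
      proof -
        obtain b where b: "b \<in> N" "a = K #> b" using \<open>a \<in> N'\<close> unfolding N'_def by blast
        have bc: "b \<in> carrier G" "inv b \<in> N" "inv b \<in> carrier G" using b NG subgroup.m_inv_closed[OF N(1)] by auto
        have "(K #> inv b) \<otimes>\<^bsub>A\<^esub> a = \<one>\<^bsub>A\<^esub>"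
          unfolding b(2) mult_A[OF bc(3,1)] one_A using coset_join2[OF _ K(1)] subgroup.one_closed[OF K(1)] bc by simp
        moreover have "a \<in> carrier A" "K #> inv b \<in> carrier A" unfolding carrier_A b(2) using b bc N(3) by auto
        ultimately have "inv\<^bsub>A\<^esub> a = K #> inv b" by (rule Am.inv_equality)
        then show ?thesis unfolding N'_def using bc by blast
      qed
    qed
  qed
  moreover have "card N' * card K = card N" unfolding N'_def by (rule card_coset_image[OF fin K(1) N(1,2)])
  moreover have "card (carrier Q) * card X = card (carrier G)"
    using lagrange[OF XS] unfolding Q_def FactGroup_def Coset.order_def by simp
  ultimately have "(card N')\<^sup>2 * card X \<le> card (carrier G)" and "card N = card N' * card K"
    using mult_le_mono1[of "(card N')\<^sup>2" "card (carrier Q)" "card X"] by simp_all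
  then show ?thesis
    using mult_le_mono2[of "(card N')\<^sup>2 * card X" "card (carrier G)" "(card K)\<^sup>2"]
    by (simp add: power_mult_distrib mult_ac)
qed

end

section \<open>The factors of the chain and their product\<close>

theorem mainTheorem16:
  fixes G :: "('a, 'b) monoid_scheme" (structure) and p n :: nat and X :: "nat \<Rightarrow> 'a set"
  assumes "group G" and "finite (carrier G)"
    and "Factorial_Ring.prime p" and "\<exists>k. card (carrier G) = p ^ k"
    and "\<not> comm_group G"
    and "nested G"
    and "X 0 = carrier G"
    and "\<forall>i<n. X (Suc i) \<subset> X i"
    and "X ` {0..n} = centers G"
    and "derived G (carrier G) \<subseteq> X n"
  shows "(\<forall>i\<in>{1..n}.
            real (card (comm_subgroup G (X (i - 1)) (carrier G))) /
            real (card (comm_subgroup G (X i) (carrier G)))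
            \<le> sqrt (real (card (carrier G)) / real (card (X i))))
       \<and> real (card (derived G (carrier G)))
            \<le> (\<Prod>i=1..n. sqrt (real (card (carrier G)) / real (card (X i))))"
proof -
  interpret group G by fact
  note fin = \<open>finite (carrier G)\<close>
  obtain m where card_G: "card (carrier G) = p ^ m" using assms(4) by blast
  have X_mono: "X j \<subseteq> X i" if "i \<le> j" "j \<le> n" for i j
    using that
  proof (induction j rule: dec_induct)
    case (step j)
    then have "X (Suc j) \<subset> X j" using assms(8) by simp
    with step show ?case by auto
  qed simp
  have XG: "X i \<subseteq> carrier G" if "i \<le> n" for i using X_mono[of 0 i] that assms(7) by simp
  have center_is_X: "\<exists>j\<le>n. char_center G \<chi> = X j" if "irr_char G \<chi>" for \<chi>
  proof -
    have "char_center G \<chi> \<in> X ` {0..n}" unfolding assms(9) centers_def using that by blast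
    then show ?thesis by auto
  qed
  define D where "D i = comm_subgroup G (X i) (carrier G)" for i
  have D: "subgroup (D i) G" if "i \<le> n" for i
    unfolding D_def by (rule subgroup_comm_subgroup[OF XG[OF that] subset_refl])
  have finD: "finite (D i)" if "i \<le> n" for i
    using D[OF that] fin subgroup.subset finite_subset by metis
  have cardD: "0 < card (D i)" if "i \<le> n" for i
    using finD[OF that] subgroup.one_closed[OF D[OF that]] by (auto simp: card_gt_0_iff)
  have derived: "derived G (carrier G) = D 0"
    unfolding D_def assms(7) by (rule derived_eq_comm_subgroup)
  \<comment> \<open>The \<open>X i\<close> are given only as sets; this makes their cardinalities
    positive.\<close>
  have one_X: "\<one> \<in> X i" if "i \<le> n" for i
    using X_mono[OF that order_refl] assms(10) derived subgroup.one_closed[OF D[of 0]] by auto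

  \<comment> \<open>\<open>X n\<close> lies in the center of every irreducible character. A
    nontrivial commutator of \<open>x\<close> avoids some kernel, which would put \<open>x\<close>
    outside the center of that character.\<close>
  have Xn_center: "X n \<subseteq> center G"
  proof
    fix x assume x: "x \<in> X n"
    have xc: "x \<in> carrier G" using x XG by blast
    have "comm G x h = \<one>" if h: "h \<in> carrier G" for h
    proof (rule ccontr)
      assume "comm G x h \<noteq> \<one>"
      then have y: "comm G x h \<in> carrier G" "comm G x h \<notin> {\<one>}" using xc h by simp_all
      obtain \<chi> K where \<chi>: "irr_char G \<chi>" "subgroup K G" "{\<one>} \<subseteq> K" "comm G x h \<notin> K"
        "char_center G \<chi> = {x \<in> carrier G. \<forall>h\<in>carrier G. inv x \<otimes> inv h \<otimes> x \<otimes> h \<in> K}"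
        by (rule separating_irr_char[OF fin one_is_normal y])
      obtain j where "j \<le> n" "char_center G \<chi> = X j" using center_is_X[OF \<chi>(1)] by blast
      then have "x \<in> char_center G \<chi>" using X_mono[of j n] x by auto
      then show False using \<chi>(4,5) h unfolding comm_def by blast
    qed
    then have "x \<otimes> h = h \<otimes> x" if "h \<in> carrier G" for h
      using mult_comm[OF xc that] that xc by simp
    then show "x \<in> center G" unfolding center_def using xc by blast
  qed
  have comm_Xn: "comm G x h \<in> X n" if "x \<in> carrier G" "h \<in> carrier G" for x h
    using comm_in_comm_subgroup[OF that] derived_eq_comm_subgroup assms(10) by auto
  have central: "comm G x h \<in> center G" if "x \<in> carrier G" "h \<in> carrier G" for x h
    using comm_Xn[OF that] Xn_center by blast
  have D_center: "D i \<subseteq> center G" if "i \<le> n" for i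
    unfolding D_def by (rule comm_subgroup_subset[OF subgroup_center]) (use central XG[OF that] in blast)
  have D_mono: "D j \<subseteq> D i" if "i \<le> j" "j \<le> n" for i j
    unfolding D_def[of j]
    by (rule comm_subgroup_subset[OF D]) (use that X_mono[OF that] comm_in_comm_subgroup D_def in auto)

  have key: "\<exists>h\<in>carrier G. \<exists>k\<in>D i. a = comm G g h \<otimes> k"
    if i: "1 \<le> i" "i \<le> n" and g: "g \<in> carrier G" "g \<notin> X i" and a: "a \<in> D (i - 1)" for i g a
  proof (rule ccontr)
    assume no: "\<not> ?thesis"
    \<comment> \<open>The product [g,G] \<open>D i\<close>. It is closed under multiplication
      because central commutators are multiplicative in the second entry.\<close>
    define M where "M = {comm G g h \<otimes> k | h k. h \<in> carrier G \<and> k \<in> D i}"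
    note Di = D[OF i(2)]
    have Dc: "k \<in> carrier G" "k \<in> center G" if "k \<in> D i" for k
      using that D_center[OF i(2)] center_closed by blast+
    have M: "subgroup M G"
    proof (rule subgroupI)
      show "M \<subseteq> carrier G" unfolding M_def using g Dc by auto
      show "M \<noteq> {}" unfolding M_def using subgroup.one_closed[OF Di] by blast
      show "x \<otimes> y \<in> M" if xy: "x \<in> M" "y \<in> M" for x y
      proof -
        obtain h k where hk: "h \<in> carrier G" "k \<in> D i" "x = comm G g h \<otimes> k" using xy(1) unfolding M_def by blast
        obtain h' k' where hk': "h' \<in> carrier G" "k' \<in> D i" "y = comm G g h' \<otimes> k'" using xy(2) unfolding M_def by blast
        have "x \<otimes> y = comm G g h \<otimes> (k \<otimes> comm G g h') \<otimes> k'"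
          using hk hk' g Dc by (simp add: m_assoc)
        also have "k \<otimes> comm G g h' = comm G g h' \<otimes> k"
          by (rule center_commute[OF Dc(2)[OF hk(2)]]) (use g hk' in simp)
        also have "comm G g h \<otimes> (comm G g h' \<otimes> k) \<otimes> k' = comm G g (h \<otimes> h') \<otimes> (k \<otimes> k')"
          using comm_mult_right[OF g(1) hk(1) hk'(1) central[OF g(1) hk(1)]] hk hk' g Dc by (simp add: m_assoc)
        finally have "x \<otimes> y = comm G g (h \<otimes> h') \<otimes> (k \<otimes> k')" .
        moreover have "h \<otimes> h' \<in> carrier G" "k \<otimes> k' \<in> D i"
          using hk hk' subgroup.m_closed[OF Di] by simp_all
        ultimately show ?thesis unfolding M_def by blast
      qed
      show "inv x \<in> M" if x: "x \<in> M" for x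
      proof -
        obtain h k where hk: "h \<in> carrier G" "k \<in> D i" "x = comm G g h \<otimes> k" using x unfolding M_def by blast
        have "comm G g h \<otimes> comm G g (inv h) = comm G g (h \<otimes> inv h)"
          by (rule comm_mult_right[symmetric]) (use g hk central in auto)
        also have "\<dots> = \<one>" using g hk by simp
        finally have "inv (comm G g (inv h)) = comm G g h"
          by (rule inv_equality) (use g hk in auto)
        then have "inv (comm G g h) = comm G g (inv h)" using g hk by (metis comm_closed inv_closed inv_inv)
        moreover have "inv x = inv k \<otimes> inv (comm G g h)" using hk g Dc by (simp add: inv_mult_group)
        moreover have ik: "inv k \<in> D i" using subgroup.m_inv_closed[OF Di hk(2)] .
        ultimately have "inv x = comm G g (inv h) \<otimes> inv k"
          using center_commute[OF Dc(2)[OF ik], of "comm G g (inv h)"] g hk by simp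
        then show ?thesis unfolding M_def using hk ik by blast
      qed
    qed
    have "M \<subseteq> center G"
      unfolding M_def using central[OF g(1)] Dc subgroup.m_closed[OF subgroup_center] by blast
    then have MN: "M \<lhd> G" by (rule center_subgroup_normal[OF M])
    have aM: "a \<notin> M" using no unfolding M_def by blast
    have "i - 1 \<le> n" using i by linarith
    then have ac: "a \<in> carrier G" using a D_center center_closed by blast
    obtain \<chi> K where \<chi>: "irr_char G \<chi>" "subgroup K G" "M \<subseteq> K" "a \<notin> K"
      "char_center G \<chi> = {x \<in> carrier G. \<forall>h\<in>carrier G. inv x \<otimes> inv h \<otimes> x \<otimes> h \<in> K}"
      by (rule separating_irr_char[OF fin MN ac aM])
    obtain j where j: "j \<le> n" "char_center G \<chi> = X j" using center_is_X[OF \<chi>(1)] by blast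
    have Xj: "X j = {x \<in> carrier G. \<forall>h\<in>carrier G. comm G x h \<in> K}"
      using \<chi>(5) unfolding j(2) comm_def .
    have "comm G g h \<in> M" if h: "h \<in> carrier G" for h
    proof -
      have "comm G g h = comm G g h \<otimes> \<one>" using g h by simp
      then show ?thesis unfolding M_def using subgroup.one_closed[OF Di] h by blast
    qed
    then have "g \<in> X j" unfolding Xj using g(1) \<chi>(3) by blast
    \<comment> \<open>\<open>g\<close> lies in \<open>X j\<close> but not in \<open>X i\<close>, so
      \<open>X j\<close> comes strictly earlier in the chain and contains \<open>X (i - 1)\<close>.
      All of \<open>D (i - 1)\<close>, and with it \<open>a\<close>, then falls into the kernel
      \<open>K\<close>.\<close>
    then have "j < i" using X_mono[of i j] j(1) g(2) by (meson in_mono not_le)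
    then have "X (i - 1) \<subseteq> X j" using X_mono[of j "i - 1"] i by simp
    then have "D (i - 1) \<subseteq> K"
      unfolding D_def by (intro comm_subgroup_subset[OF \<chi>(2)]) (use Xj in blast)
    then show False using a \<chi>(4) by blast
  qed

  have ratio: "real (card (D (i - 1))) / real (card (D i)) \<le> sqrt (real (card (carrier G)) / real (card (X i)))"
    if i: "1 \<le> i" "i \<le> n" for i
  proof -
    have finX: "finite (X i)" using XG[OF i(2)] fin finite_subset by blast
    have cX: "0 < card (X i)" using finX one_X[OF i(2)] by (auto simp: card_gt_0_iff)
    have i': "i - 1 \<le> n" using i by simp
    show ?thesis
    \<comment> \<open>Equality has to be split off: then every element of \<open>X (i - 1)\<close>
      has all its commutators in \<open>D i\<close>, so \<open>X i\<close> is not the full set of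
      such elements and the description \<open>Xi\<close> fails. The ratio is 1 in that
      case.\<close>
    proof (cases "D (i - 1) = D i")
      case True
      have "card (X i) \<le> card (carrier G)" by (rule card_mono[OF fin XG[OF i(2)]])
      then have "1 \<le> real (card (carrier G)) / real (card (X i))" using cX by simp
      then show ?thesis unfolding True using cardD[OF i(2)] by simp
    next
      case False
      have Xi: "X i = {g \<in> carrier G. \<forall>h\<in>carrier G. comm G g h \<in> D i}"
      proof (intro equalityI subsetI)
        fix g assume "g \<in> X i"
        then show "g \<in> {g \<in> carrier G. \<forall>h\<in>carrier G. comm G g h \<in> D i}"
          using XG[OF i(2)] comm_in_comm_subgroup unfolding D_def by blast
      next
        fix g assume g: "g \<in> {g \<in> carrier G. \<forall>h\<in>carrier G. comm G g h \<in> D i}"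
        show "g \<in> X i"
        proof (rule ccontr)
          assume "g \<notin> X i"
          then have "D (i - 1) \<subseteq> D i"
            using key[OF i] g subgroup.m_closed[OF D[OF i(2)]] by blast
          then show False using False D_mono[of "i - 1" i] i by simp
        qed
      qed
      have "X i \<subset> X (i - 1)" using assms(8) i by (cases i) auto
      then have ne: "X i \<noteq> carrier G" using XG[OF i'] by blast
      have "(card (D (i - 1)))\<^sup>2 * card (X i) \<le> (card (D i))\<^sup>2 * card (carrier G)"
        by (rule commutator_pairing_bound[OF fin assms(3) card_G central D[OF i(2)] D_center[OF i(2)]
              D[OF i'] D_mono[OF _ i(2)] D_center[OF i'] Xi ne key[OF i]]) auto
      then have "real ((card (D (i - 1)))\<^sup>2 * card (X i)) \<le> real ((card (D i))\<^sup>2 * card (carrier G))"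
        by (simp only: of_nat_le_iff)
      then have "(real (card (D (i - 1))) / real (card (D i)))\<^sup>2 \<le> real (card (carrier G)) / real (card (X i))"
        using cX cardD[OF i(2)] by (simp add: power_divide field_simps)
      then show ?thesis by (rule real_le_rsqrt)
    qed
  qed

  have telescope: "(\<Prod>i=1..k. real (card (D (i - 1))) / real (card (D i))) = real (card (D 0)) / real (card (D k))"
    if "k \<le> n" for k
    using that
  proof (induction k)
    case 0
    then show ?case using cardD[of 0] by simp
  next
    case (Suc k)
    then show ?case using cardD[of k] by simp
  qed
  \<comment> \<open>The last denominator of the telescoping product, so that the product equals the
    order of the derived subgroup.\<close>
  have "D n = {\<one>}"
  proof
    have "comm G x h = \<one>" if "x \<in> X n" "h \<in> carrier G" for x h
      by (rule comm_unique) (use that Xn_center center_closed center_commute in auto)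
    then show "D n \<subseteq> {\<one>}"
      unfolding D_def by (intro comm_subgroup_subset[OF triv_subgroup]) simp
    show "{\<one>} \<subseteq> D n" using subgroup.one_closed[OF D[of n]] by simp
  qed
  then have "real (card (D 0)) = (\<Prod>i=1..n. real (card (D (i - 1))) / real (card (D i)))"
    using telescope[of n] by simp
  also have "\<dots> \<le> (\<Prod>i=1..n. sqrt (real (card (carrier G)) / real (card (X i))))"
    by (rule prod_mono) (use ratio in auto)
  finally show ?thesis unfolding derived using ratio unfolding D_def by auto
qed

end
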